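(* If $M$ is a closed enlargeable manifold, then $M$ is filling enlargeable.
   Context: All manifolds are assumed to be connected. A Riemannian metric on a manifold, if not required to be smooth, is a polyhedral metric with respect to some smooth triangulation, i.e. a compatible choice, on each simplex, of a pullback of a Riemannian metric on $\mathbb{R}^k$ via an affine linear embedding (smooth metrics are included by choosing a smooth triangulation). A closed orientable manifold $M^n$ is called enlargeable if for every Riemannian metric $g$ on $M$ and every $r>0$ there is a Riemannian covering $\overline{M}_r$ of $(M,g)$ and a distance decreasing (i.e. $1$-Lipschitz) almost proper map (i.e. constant outside a compact set) $f_r:\overline{M}_r\to S^n(r)$ to the round sphere of radius $r$ with $\deg(f_r)\neq 0$. Filling radius: for a complete oriented Riemannian manifold $(N^n,h)$ with path metric $d_h$, let $[N]$ be its fundamental class in locally finite homology $H_n^{lf}(N)$ (homology of infinite singular chains such that each bounded subset meets only finitely many simplices). Let $L^\infty(N)$ be the space of all functions $N\to\mathbb{R}$ with the uniform (possibly infinite) norm, and $L^\infty(N)_b$ the affine subspace parallel to the Banach space of bounded functions containing $d_h(x,\cdot)$ for some $x\in N$; it is a metric space via $\|\cdot\|_\infty$. The Kuratowski embedding is $\iota_h:N\to L^\infty(N)_b$, $x\mapsto d_h(x,\cdot)$. Then $\mathrm{FillRad}(N,h)=\inf\{r>0:\iota_{h*}[N]=0\in H_n^{lf}(U_r(\iota_hN);\mathbb{Q})\}$, where $U_r$ is the open $r$-neighborhood in $L^\infty(N)_b$ ($\infty$ if the set is empty). A closed orientable manifold $M$ is called filling enlargeable if for every Riemannian metric $g$ on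 $M$ and every $r>0$ there is a Riemannian covering $\overline{M}_r$ of $M$ (possibly infinite-sheeted) with $\mathrm{FillRad}(\overline{M}_r,\overline g)\geq r$, where $\overline g$ is the lifted metric. *)

theory Defs
  imports "HOL-Analysis.Analysis" "HOL-Homology.Homology"
begin

section \<open>Closed orientable smooth manifolds\<close>

primrec Ck_on :: "nat \<Rightarrow> 'v::euclidean_space set \<Rightarrow> ('v \<Rightarrow> 'w::real_normed_vector) \<Rightarrow> bool" where
  "Ck_on 0 W f \<longleftrightarrow> continuous_on W f"
| "Ck_on (Suc k) W f \<longleftrightarrow> (\<forall>x\<in>W. f differentiable (at x)) \<and>
     (\<forall>b\<in>Basis. Ck_on k W (\<lambda>x. frechet_derivative f (at x) b))"

text \<open>Meant for open sets only.\<close>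

definition smooth_on :: "'v::euclidean_space set \<Rightarrow> ('v \<Rightarrow> 'w::real_normed_vector) \<Rightarrow> bool" where
  "smooth_on W f \<longleftrightarrow> (\<forall>k. Ck_on k W f)"

text \<open>A chart is a pair of its domain and its coordinate map. The dimension
  \<open>CARD('n)\<close> is at least 1.\<close>

type_synonym ('a, 'n) chart = "'a set \<times> ('a \<Rightarrow> real^'n)"

definition smooth_atlas :: "'a topology \<Rightarrow> ('a, 'n::finite) chart set \<Rightarrow> bool" where
  "smooth_atlas M A \<longleftrightarrow>
     (\<forall>(U, \<phi>)\<in>A. openin M U \<and>
        (\<exists>V. open V \<and> homeomorphic_map (subtopology M U) (top_of_set V) \<phi>)) \<and>
     (\<Union>(U, \<phi>)\<in>A. U) = topspace M \<and>
     (\<forall>(U, \<phi>)\<in>A. \<forall>(U', \<phi>')\<in>A. smooth_on (\<phi> ` (U \<inter> U')) (\<phi>' \<circ> inv_into U \<phi>))"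

definition closed_manifold :: "'a topology \<Rightarrow> ('a, 'n::finite) chart set \<Rightarrow> bool" where
  "closed_manifold M A \<longleftrightarrow>
     topspace M \<noteq> {} \<and> connected_space M \<and> Hausdorff_space M \<and> second_countable M \<and>
     compact_space M \<and> smooth_atlas M A"

definition orientable :: "'a topology \<Rightarrow> ('a, 'n::finite) chart set \<Rightarrow> bool" where
  "orientable M A \<longleftrightarrow>
     (\<exists>B. smooth_atlas M B \<and> smooth_atlas M (A \<union> B) \<and>
        (\<forall>(U, \<phi>)\<in>B. \<forall>(U', \<phi>')\<in>B. \<forall>x\<in>U \<inter> U'.
           det (matrix (frechet_derivative (\<phi>' \<circ> inv_into U \<phi>) (at (\<phi> x)))) > 0))"


section \<open>Polyhedral Riemannian metrics\<close>

text \<open>The simplicial complexes triangulating a closed \<open>n\<close>-manifold are finite and of dimension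
  at most \<open>n\<close>, so they can be realised linearly in a Euclidean space of dimension \<open>2n+1\<close>.\<close>

type_synonym 'n ambient = "(real^'n) \<times> (real^'n) \<times> real"

definition riemannian_metric :: "('v::euclidean_space \<Rightarrow> 'v \<Rightarrow> 'v \<Rightarrow> real) \<Rightarrow> bool" where
  "riemannian_metric G \<longleftrightarrow>
     (\<forall>x. bilinear (G x) \<and> (\<forall>u v. G x u v = G x v u) \<and> (\<forall>u. u \<noteq> 0 \<longrightarrow> G x u u > 0)) \<and>
     (\<forall>u v. smooth_on UNIV (\<lambda>x. G x u v))"

definition tangent_space :: "'v::euclidean_space set \<Rightarrow> 'v set" where
  "tangent_space S = span {y - x | x y. x \<in> S \<and> y \<in> S}"

text \<open>The restriction of the homeomorphism \<open>h\<close> to each closed simplex is a smooth embedding: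
  in charts it extends locally to a smooth map whose differential is injective on the
  directions of the simplex.\<close>

definition smooth_triangulation ::
  "'a topology \<Rightarrow> ('a, 'n::finite) chart set \<Rightarrow> 'n ambient set set \<Rightarrow> ('n ambient \<Rightarrow> 'a) \<Rightarrow> bool" where
  "smooth_triangulation M A K h \<longleftrightarrow>
     simplicial_complex K \<and> homeomorphic_map (top_of_set (\<Union>K)) M h \<and>
     (\<forall>S\<in>K. \<forall>x\<in>S. \<forall>(U, \<phi>)\<in>A. h x \<in> U \<longrightarrow>
        (\<exists>W F. open W \<and> x \<in> W \<and> smooth_on W F \<and>
           (\<forall>y\<in>S \<inter> W. h y \<in> U \<and> F y = \<phi> (h y)) \<and>
           (\<forall>v\<in>tangent_space S. frechet_derivative F (at x) v = 0 \<longrightarrow> v = 0)))"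

record ('a, 'n) polyhedral =
  cells :: "'n ambient set set"
  param :: "'n ambient \<Rightarrow> 'a"
  gtensor :: "'n ambient set \<Rightarrow> 'n ambient \<Rightarrow> 'n ambient \<Rightarrow> 'n ambient \<Rightarrow> real"

text \<open>\<open>gtensor g S\<close> is a Riemannian metric on the whole ambient Euclidean space, and only its
  pullback under the affine inclusion of \<open>S\<close>, that is its values at points of \<open>S\<close> on
  \<open>tangent_space S\<close>, matters. Every Riemannian metric on the affine hull of \<open>S\<close> extends to the
  ambient space, so pullbacks along other affine embeddings give nothing new.\<close>

definition polyhedral_metric ::
  "'a topology \<Rightarrow> ('a, 'n::finite) chart set \<Rightarrow> ('a, 'n) polyhedral \<Rightarrow> bool" where
  "polyhedral_metric M A g \<longleftrightarrow>
     smooth_triangulation M A (cells g) (param g) \<and>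
     (\<forall>S\<in>cells g. riemannian_metric (gtensor g S)) \<and>
     (\<forall>S\<in>cells g. \<forall>T\<in>cells g. T face_of S \<longrightarrow>
        (\<forall>x\<in>T. \<forall>u\<in>tangent_space T. \<forall>v\<in>tangent_space T. gtensor g T x u v = gtensor g S x u v))"


section \<open>Riemannian coverings\<close>

definition covering_map :: "'c topology \<Rightarrow> 'a topology \<Rightarrow> ('c \<Rightarrow> 'a) \<Rightarrow> bool" where
  "covering_map X Y p \<longleftrightarrow>
     continuous_map X Y p \<and> p ` topspace X = topspace Y \<and>
     (\<forall>y\<in>topspace Y. \<exists>V. openin Y V \<and> y \<in> V \<and>
        (\<exists>\<U>. pairwise disjnt \<U> \<and> \<Union>\<U> = {x \<in> topspace X. p x \<in> V} \<and>
           (\<forall>U\<in>\<U>. openin X U \<and> homeomorphic_map (subtopology X U) (subtopology Y V) p)))"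

text \<open>\<open>lifted_path X p g x y l\<close>: in the covering space \<open>X\<close>, with the metric lifted from \<open>g\<close> along
  \<open>p\<close>, there is a path from \<open>x\<close> to \<open>y\<close> of length \<open>l\<close> which is a concatenation of finitely many
  pieces, each lying over one closed simplex \<open>S\<close> of the triangulation and of class \<open>C\<^sup>1\<close> there.
  The length of a piece is that of its projection.\<close>

inductive lifted_path ::
  "'c topology \<Rightarrow> ('c \<Rightarrow> 'a) \<Rightarrow> ('a, 'n::finite) polyhedral \<Rightarrow> 'c \<Rightarrow> 'c \<Rightarrow> real \<Rightarrow> bool"
  for X p g where
  refl: "x \<in> topspace X \<Longrightarrow> lifted_path X p g x x 0"
| step: "\<lbrakk>lifted_path X p g x (\<gamma> 0) l; pathin X \<gamma>; S \<in> cells g; c C1_differentiable_on {0..1};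
     \<forall>t\<in>{0..1}. c t \<in> S \<and> p (\<gamma> t) = param g (c t)\<rbrakk> \<Longrightarrow>
     lifted_path X p g x (\<gamma> 1)
       (l + integral {0..1}
          (\<lambda>t. sqrt (gtensor g S (c t) (vector_derivative c (at t)) (vector_derivative c (at t)))))"

definition lifted_dist ::
  "'c topology \<Rightarrow> ('c \<Rightarrow> 'a) \<Rightarrow> ('a, 'n::finite) polyhedral \<Rightarrow> 'c \<Rightarrow> 'c \<Rightarrow> real" where
  "lifted_dist X p g x y =
     (if x \<in> topspace X \<and> y \<in> topspace X then Inf {l. lifted_path X p g x y l} else 0)"

text \<open>Coverings are connected, like all manifolds here. A connected covering of a closed manifold
  with carrier in \<open>'a\<close> has countable fibres (its fundamental group is countable), hence up to
  isomorphism its carrier lies in \<open>'a \<times> nat\<close>. This justifies the type of covering spaces.\<close>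

definition connected_covering :: "('a \<times> nat) topology \<Rightarrow> 'a topology \<Rightarrow> ('a \<times> nat \<Rightarrow> 'a) \<Rightarrow> bool" where
  "connected_covering X M p \<longleftrightarrow> connected_space X \<and> covering_map X M p"


section \<open>Locally finite homology\<close>

text \<open>Infinite singular chains with coefficients in \<open>'k\<close>, as coefficient functions. The topology
  and the distance are passed separately; the distance only enters via bounded subsets.\<close>

type_synonym ('x, 'k) lfchain = "((nat \<Rightarrow> real) \<Rightarrow> 'x) \<Rightarrow> 'k"

definition lf_chain ::
  "nat \<Rightarrow> 'x topology \<Rightarrow> ('x \<Rightarrow> 'x \<Rightarrow> real) \<Rightarrow> ('x, 'k::comm_ring_1) lfchain \<Rightarrow> bool" where
  "lf_chain q X d c \<longleftrightarrow>
     (\<forall>\<sigma>. c \<sigma> \<noteq> 0 \<longrightarrow> singular_simplex q X \<sigma>) \<and>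
     (\<forall>B x R. B \<subseteq> topspace X \<and> x \<in> topspace X \<and> (\<forall>y\<in>B. d x y \<le> R) \<longrightarrow>
        finite {\<sigma>. c \<sigma> \<noteq> 0 \<and> \<sigma> ` standard_simplex q \<inter> B \<noteq> {}})"

text \<open>For locally finite \<open>c\<close> the sums below have finitely many terms: all simplices
  with \<open>\<tau>\<close> as a face meet its bounded nonempty image. The pushforward is only used for the
  isometric Kuratowski embedding, where the same argument applies.\<close>

definition lf_boundary :: "nat \<Rightarrow> ('x, 'k::comm_ring_1) lfchain \<Rightarrow> ('x, 'k) lfchain" where
  "lf_boundary q c \<tau> = (if q = 0 then 0 else
     \<Sum>(\<sigma>, k) \<in> {(\<sigma>, k). c \<sigma> \<noteq> 0 \<and> k \<le> q \<and> singular_face q k \<sigma> = \<tau>}. (-1) ^ k * c \<sigma>)"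

definition lf_push ::
  "nat \<Rightarrow> ('x \<Rightarrow> 'y) \<Rightarrow> ('x, 'k::comm_ring_1) lfchain \<Rightarrow> ('y, 'k) lfchain" where
  "lf_push q f c \<tau> = (\<Sum>\<sigma> | c \<sigma> \<noteq> 0 \<and> simplex_map q f \<sigma> = \<tau>. c \<sigma>)"

text \<open>The finite part of an integral chain carried by the simplices meeting a bounded set \<open>K\<close>. If
  \<open>z\<close> is a cycle, this represents its image in the homology relative to the complement of \<open>K\<close>.\<close>

definition part_meeting :: "nat \<Rightarrow> 'x set \<Rightarrow> ('x, int) lfchain \<Rightarrow> 'x chain" where
  "part_meeting q K z =
     (\<Sum>\<sigma> | z \<sigma> \<noteq> 0 \<and> \<sigma> ` standard_simplex q \<inter> K \<noteq> {}. frag_cmul (z \<sigma>) (frag_of \<sigma>))"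

definition class_rel_compl :: "nat \<Rightarrow> 'x topology \<Rightarrow> 'x set \<Rightarrow> ('x, int) lfchain \<Rightarrow> 'x chain set" where
  "class_rel_compl q X K z = homologous_rel_set q X (topspace X - K) (part_meeting q K z)"

definition is_generator :: "('g, 'b) monoid_scheme \<Rightarrow> 'g \<Rightarrow> bool" where
  "is_generator G a \<longleftrightarrow> a \<in> carrier G \<and> subgroup_generated G {a} = G"

text \<open>\<open>z\<close> represents the fundamental class of the \<open>n\<close>-manifold \<open>X\<close> for one of its orientations.
  On a connected orientable manifold its homology class is unique up to sign; the cycle \<open>z\<close> plays
  the role of the chosen orientation below.\<close>

definition fundamental_cycle ::
  "nat \<Rightarrow> 'x topology \<Rightarrow> ('x \<Rightarrow> 'x \<Rightarrow> real) \<Rightarrow> ('x, int) lfchain \<Rightarrow> bool" where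
  "fundamental_cycle n X d z \<longleftrightarrow>
     lf_chain n X d z \<and> lf_boundary n z = (\<lambda>_. 0) \<and>
     (\<forall>x\<in>topspace X.
        is_generator (relative_homology_group (int n) X (topspace X - {x})) (class_rel_compl n X {x} z))"


section \<open>Enlargeability\<close>

text \<open>The round sphere \<open>S\<^sup>n(r)\<close> is \<open>sphere 0 r\<close> in the \<open>(n+1)\<close>-dimensional Euclidean space
  \<open>(real^'n) \<times> real\<close>, with its great-circle distance.\<close>

definition sphere_dist :: "real \<Rightarrow> 'v::real_inner \<Rightarrow> 'v \<Rightarrow> real" where
  "sphere_dist r x y = r * arccos ((x \<bullet> y) / r\<^sup>2)"

definition almost_proper :: "'x topology \<Rightarrow> ('x \<Rightarrow> 'v) \<Rightarrow> 'v set \<Rightarrow> bool" where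
  "almost_proper X f Y \<longleftrightarrow>
     (\<exists>K y0. compactin X K \<and> y0 \<in> Y \<and> (\<forall>x\<in>topspace X - K. f x = y0))"

text \<open>If \<open>f\<close> has constant value \<open>y0\<close> outside the compact set \<open>K\<close>, its degree is the integer \<open>k\<close>
  for which \<open>H\<^sub>n(X, X - K) \<rightarrow> H\<^sub>n(S\<^sup>n(r), y0) \<cong> \<int>\<close> maps the image of the fundamental class to \<open>k\<close> times
  a generator \<open>e\<close>. The sphere is not given a preferred orientation here, so \<open>k\<close> is
  determined up to sign.\<close>

definition has_degree ::
  "'x topology \<Rightarrow> ('x, int) lfchain \<Rightarrow> real \<Rightarrow> ('x \<Rightarrow> (real^'n::finite) \<times> real) \<Rightarrow> int \<Rightarrow> bool" where
  "has_degree X z r f k \<longleftrightarrow>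
     (\<exists>K y0 e. compactin X K \<and> y0 \<in> sphere 0 r \<and> (\<forall>x\<in>topspace X - K. f x = y0) \<and>
        (let n = CARD('n); Sph = top_of_set (sphere 0 r);
             G = relative_homology_group (int n) Sph {y0}
         in is_generator G e \<and>
            hom_induced (int n) X (topspace X - K) Sph {y0} f (class_rel_compl n X K z) = e [^]\<^bsub>G\<^esub> k))"

definition enlargeable :: "'a topology \<Rightarrow> ('a, 'n::finite) chart set \<Rightarrow> bool" where
  "enlargeable M A \<longleftrightarrow>
     closed_manifold M A \<and> orientable M A \<and>
     (\<forall>g r. polyhedral_metric M A g \<and> r > 0 \<longrightarrow>
        (\<exists>X p z. \<exists>f :: 'a \<times> nat \<Rightarrow> (real^'n) \<times> real.
           connected_covering X M p \<and>
           fundamental_cycle CARD('n) X (lifted_dist X p g) z \<and>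
           continuous_map X (top_of_set (sphere 0 r)) f \<and>
           (\<forall>x\<in>topspace X. \<forall>y\<in>topspace X. sphere_dist r (f x) (f y) \<le> lifted_dist X p g x y) \<and>
           almost_proper X f (sphere 0 r) \<and>
           (\<exists>k. k \<noteq> 0 \<and> has_degree X z r f k)))"


section \<open>Filling radius\<close>

text \<open>The metric space \<open>L\<^sup>\<infinity>(X)\<^sub>b\<close>. Functions on \<open>topspace X\<close> are represented extensionally.\<close>

definition linf_b :: "'x topology \<Rightarrow> ('x \<Rightarrow> 'x \<Rightarrow> real) \<Rightarrow> ('x \<Rightarrow> real) set" where
  "linf_b X d = {u \<in> extensional (topspace X).
     \<exists>x\<in>topspace X. bounded ((\<lambda>y. u y - d x y) ` topspace X)}"

definition linf_dist ::
  "'x topology \<Rightarrow> ('x \<Rightarrow> 'x \<Rightarrow> real) \<Rightarrow> ('x \<Rightarrow> real) \<Rightarrow> ('x \<Rightarrow> real) \<Rightarrow> real" where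
  "linf_dist X d u v =
     (if u \<in> linf_b X d \<and> v \<in> linf_b X d then (SUP y\<in>topspace X. \<bar>u y - v y\<bar>) else 0)"

lemma linf_diff_bounded:
  assumes "Metric_space (topspace X) d" "u \<in> linf_b X d" "v \<in> linf_b X d"
  shows "bdd_above ((\<lambda>y. \<bar>u y - v y\<bar>) ` topspace X)"
proof -
  interpret Metric_space "topspace X" d by fact
  obtain x B where x: "x \<in> topspace X" "\<And>y. y \<in> topspace X \<Longrightarrow> \<bar>u y - d x y\<bar> \<le> B"
    using assms(2) by (auto simp: linf_b_def bounded_iff)
  obtain x' B' where x': "x' \<in> topspace X" "\<And>y. y \<in> topspace X \<Longrightarrow> \<bar>v y - d x' y\<bar> \<le> B'"
    using assms(3) by (auto simp: linf_b_def bounded_iff)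
  show ?thesis
  proof (rule bdd_aboveI2)
    fix y assume y: "y \<in> topspace X"
    show "\<bar>u y - v y\<bar> \<le> B + B' + d x x'"
      using x(2)[OF y] x'(2)[OF y] triangle[OF x(1) x'(1) y] triangle[OF x'(1) x(1) y] commute[of x x']
      by linarith
  qed
qed

lemma Metric_space_linf:
  assumes "Metric_space (topspace X) d"
  shows "Metric_space (linf_b X d) (linf_dist X d)"
proof -
  have ne: "topspace X \<noteq> {}" if "u \<in> linf_b X d" for u
    using that by (auto simp: linf_b_def)
  have up: "\<bar>u y - v y\<bar> \<le> linf_dist X d u v"
    if "u \<in> linf_b X d" "v \<in> linf_b X d" "y \<in> topspace X" for u v y
    using cSUP_upper[OF that(3) linf_diff_bounded[OF assms that(1,2)]] that
    by (simp add: linf_dist_def)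
  have least: "linf_dist X d u v \<le> B"
    if "u \<in> linf_b X d" "v \<in> linf_b X d" "\<And>y. y \<in> topspace X \<Longrightarrow> \<bar>u y - v y\<bar> \<le> B" for u v B
    using cSUP_least[of "topspace X" "\<lambda>y. \<bar>u y - v y\<bar>" B] that ne[OF that(1)]
    by (simp add: linf_dist_def)
  show ?thesis
  proof
    fix u v :: "'a \<Rightarrow> real"
    show "linf_dist X d u v = linf_dist X d v u"
      by (simp add: linf_dist_def abs_minus_commute)
    show "0 \<le> linf_dist X d u v"
    proof (cases "u \<in> linf_b X d \<and> v \<in> linf_b X d")
      case True
      then show ?thesis
        using ne up abs_ge_zero order_trans by (metis ex_in_conv)
    qed (auto simp: linf_dist_def)
  next
    fix u v assume uv: "u \<in> linf_b X d" "v \<in> linf_b X d"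
    show "linf_dist X d u v = 0 \<longleftrightarrow> u = v"
    proof
      assume "linf_dist X d u v = 0"
      then have "u y = v y" if "y \<in> topspace X" for y
        using up[OF uv that] by simp
      moreover have "u \<in> extensional (topspace X)" "v \<in> extensional (topspace X)"
        using uv by (auto simp: linf_b_def)
      ultimately show "u = v" by (meson extensionalityI)
    next
      assume "u = v"
      then show "linf_dist X d u v = 0"
        using ne[OF uv(1)] by (simp add: linf_dist_def)
    qed
  next
    fix u v w assume uvw: "u \<in> linf_b X d" "v \<in> linf_b X d" "w \<in> linf_b X d"
    show "linf_dist X d u w \<le> linf_dist X d u v + linf_dist X d v w"
    proof (rule least[OF uvw(1,3)])
      fix y assume "y \<in> topspace X"
      then show "\<bar>u y - w y\<bar> \<le> linf_dist X d u v + linf_dist X d v w"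
        using up[OF uvw(1,2)] up[OF uvw(2,3)] by fastforce
    qed
  qed
qed

definition kuratowski :: "'x topology \<Rightarrow> ('x \<Rightarrow> 'x \<Rightarrow> real) \<Rightarrow> 'x \<Rightarrow> 'x \<Rightarrow> real" where
  "kuratowski X d x = restrict (d x) (topspace X)"

definition kuratowski_nbhd :: "'x topology \<Rightarrow> ('x \<Rightarrow> 'x \<Rightarrow> real) \<Rightarrow> real \<Rightarrow> ('x \<Rightarrow> real) topology" where
  "kuratowski_nbhd X d r =
     subtopology (Metric_space.mtopology (linf_b X d) (linf_dist X d))
       {u \<in> linf_b X d. \<exists>x\<in>topspace X. linf_dist X d u (kuratowski X d x) < r}"

text \<open>The filling radius of the \<open>n\<close>-manifold \<open>X\<close> with distance \<open>d\<close> and fundamental class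
  represented by \<open>z\<close>.\<close>

definition FillRad ::
  "nat \<Rightarrow> 'x topology \<Rightarrow> ('x \<Rightarrow> 'x \<Rightarrow> real) \<Rightarrow> ('x, int) lfchain \<Rightarrow> ereal" where
  "FillRad n X d z = Inf {ereal r | r. r > 0 \<and>
     (\<exists>b :: ('x \<Rightarrow> real, rat) lfchain.
        lf_chain (Suc n) (kuratowski_nbhd X d r) (linf_dist X d) b \<and>
        lf_boundary (Suc n) b = lf_push n (kuratowski X d) (\<lambda>\<sigma>. of_int (z \<sigma>)))}"

definition filling_enlargeable :: "'a topology \<Rightarrow> ('a, 'n::finite) chart set \<Rightarrow> bool" where
  "filling_enlargeable M A \<longleftrightarrow>
     closed_manifold M A \<and> orientable M A \<and>
     (\<forall>g r. polyhedral_metric M A g \<and> r > 0 \<longrightarrow>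
        (\<exists>X p z.
           connected_covering X M p \<and>
           fundamental_cycle CARD('n) X (lifted_dist X p g) z \<and>
           FillRad CARD('n) X (lifted_dist X p g) z \<ge> ereal r))"

end

theory Submission
  imports Defs
begin

text \<open>
  Enlargeability provides, over a covering \<open>X\<close> of \<open>M\<close>, a \<open>1\<close>-Lipschitz map \<open>f\<close> of nonzero degree to a
  sphere whose radius \<open>R\<close> may be prescribed. The covering that it provides for \<open>R = (n + 1) r\<close>, where \<open>n\<close>
  is the dimension of \<open>M\<close>, has filling radius at least \<open>r\<close>: a
  rational filling of the fundamental class inside a \<open>\<rho>\<close>-neighbourhood \<open>U\<close> of the Kuratowski image with
  \<open>\<rho> < r\<close> could be mapped to the sphere, and this would kill a nonzero multiple of a generator of its top homology.

  The map to the sphere is found coordinatewise. Every coordinate of \<open>f\<close> is \<open>1\<close>-Lipschitz for the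
  uniform norm on the Kuratowski image, and so extends to a \<open>1\<close>-Lipschitz function on the whole of
  \<open>L\<^sup>\<infinity>(X)\<^sub>b\<close> by McShane's formula. The resulting vector-valued map \<open>G\<close> is \<open>(n + 1)\<close>-Lipschitz, so on \<open>U\<close>
  it stays at distance less than \<open>(n + 1) r = R\<close> from points of the sphere, hence away from the origin, and
  can be projected radially to the sphere (\<open>sphere_valued_extension\<close>). The same estimate shows that
  \<open>F\<close>, the projected map, cannot send a point within \<open>\<rho>\<close> of the image of \<open>x\<close> to the antipode of \<open>f x\<close>.

  The extension \<open>F\<close> is not constant near infinity, and the filling is an infinite chain. Both defects
  are repaired at once by working relative to a punctured sphere. If \<open>f\<close> is constant with value
  \<open>y0\<close> outside the compact set \<open>K\<close>, then \<open>F\<close> misses \<open>- y0\<close> outside the bounded set \<open>B\<close> of points within \<open>\<rho>\<close> of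
  the image of \<open>K\<close>. Only finitely many simplices of the filling meet \<open>B\<close>. Keeping just these and
  clearing denominators gives an integral finite chain whose boundary agrees, on simplices that meet \<open>B\<close>,
  with a multiple of the image of the fundamental cycle (\<open>truncated_filling\<close>). Its image under \<open>F\<close> shows that a
  multiple of the image of the fundamental class bounds relative to the sphere without \<open>- y0\<close>. Since
  the punctured sphere is contractible, passing from \<open>y0\<close> to it does not change relative homology, and since
  the top homology of a sphere is infinite cyclic, the degree of \<open>f\<close> has to vanish
  (\<open>degree_eq_0_if_multiple_bounds_rel_punctured_sphere\<close>).

  The metric input is that the lifted distance is a finite pseudometric which is bounded on compact
  sets. Finiteness is a connectedness argument: points in a small ball of the triangulation around a given
  point can be reached along straight segments inside one simplex, and these lift through the sheet
  of an evenly covered set.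
\<close>

section \<open>The distance on a covering\<close>

text \<open>The Kuratowski embedding and the filling radius are governed by distances alone, so they
  make sense for a pseudometric. For lengths of paths the axioms of a pseudometric follow
  from concatenation and reversal of paths.\<close>

locale pseudometric_on =
  fixes S :: "'x set" and d :: "'x \<Rightarrow> 'x \<Rightarrow> real"
  assumes nonneg: "\<And>x y. 0 \<le> d x y"
    and sym: "\<And>x y. d x y = d y x"
    and self: "\<And>x. x \<in> S \<Longrightarrow> d x x = 0"
    and triangle: "\<And>x y z. \<lbrakk>x \<in> S; y \<in> S; z \<in> S\<rbrakk> \<Longrightarrow> d x z \<le> d x y + d y z"

text \<open>Reflection preserves both the value of an integral and integrability; the default value \<open>0\<close> of the
  integral of a function that is not integrable is therefore covered as well.\<close>

lemma integral_reverse_unit_interval: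
  fixes \<phi> :: "real \<Rightarrow> real"
  shows "integral {0..1} (\<lambda>t. \<phi> (1 - t)) = integral {0..1} \<phi>"
proof -
  have rev: "((\<lambda>t. \<psi> (1 - t)) has_integral i) {0..1}" if "(\<psi> has_integral i) {0..1}" for \<psi> :: "real \<Rightarrow> real" and i
  proof -
    have "((\<lambda>t. \<psi> (1 - t)) has_integral i) ((\<lambda>t. 1 - t) ` {0..1})"
      using has_integral_affinity[of \<psi> i 0 1 "-1" 1] that by (simp add: o_def)
    moreover have "(\<lambda>t. 1 - t) ` {0..1} = {0..1::real}"
      by (auto simp: image_iff intro!: bexI[of _ "1 - _"])
    ultimately show ?thesis by simp
  qed
  have "((\<lambda>t. \<phi> (1 - t)) has_integral i) {0..1} \<longleftrightarrow> (\<phi> has_integral i) {0..1}" for i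
    using rev[of \<phi> i] rev[of "\<lambda>t. \<phi> (1 - t)" i] by auto
  then show ?thesis
    by (simp add: integral_def integrable_on_def)
qed

lemma integral_unit_interval_bounds:
  fixes \<phi> :: "real \<Rightarrow> real"
  assumes "\<And>t. t \<in> {0..1} \<Longrightarrow> 0 \<le> \<phi> t"
  shows "0 \<le> integral {0..1} \<phi>"
    and "0 \<le> C \<Longrightarrow> (\<And>t. t \<in> {0..1} \<Longrightarrow> \<phi> t \<le> C) \<Longrightarrow> integral {0..1} \<phi> \<le> C"
proof -
  show "0 \<le> integral {0..1} \<phi>"
    using assms by (cases "\<phi> integrable_on {0..1}") (auto simp: not_integrable_integral intro: integral_nonneg)
  show "integral {0..1} \<phi> \<le> C" if "0 \<le> C" "\<And>t. t \<in> {0..1} \<Longrightarrow> \<phi> t \<le> C"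
    using that integral_le[of \<phi> "{0..1}" "\<lambda>_. C"]
    by (cases "\<phi> integrable_on {0..1}") (auto simp: not_integrable_integral)
qed

lemma riemannian_metric_nonneg:
  "riemannian_metric G \<Longrightarrow> 0 \<le> G x v v"
  unfolding riemannian_metric_def
  by (cases "v = 0") (auto simp: bilinear_lzero less_imp_le)

text \<open>Expand the quadratic form in the standard basis; the coefficients are continuous, hence bounded
  on \<open>S\<close>. This bounds the speed of segments that start at a given point of a simplex.\<close>

lemma riemannian_metric_bounded_on_compact:
  fixes S :: "'v::euclidean_space set"
  assumes G: "riemannian_metric G" and S: "compact S"
  obtains C where "C \<ge> 0" and "\<And>x v. \<lbrakk>x \<in> S; norm v \<le> \<epsilon>\<rbrakk> \<Longrightarrow> sqrt (G x v v) \<le> C"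
proof -
  \<comment> \<open>The sum of the absolute values of the coefficients of the form at \<open>x\<close>.\<close>
  define T where "T x = (\<Sum>i\<in>Basis. \<Sum>j\<in>Basis. \<bar>G x i j\<bar>)" for x
  have "continuous_on S (\<lambda>x. G x u v)" for u v
  proof -
    have "Ck_on 0 UNIV (\<lambda>x. G x u v)"
      using G unfolding riemannian_metric_def smooth_on_def by blast
    then show ?thesis
      using continuous_on_subset by auto
  qed
  then have "continuous_on S T"
    unfolding T_def by (intro continuous_intros)
  then have "bounded (T ` S)"
    using S compact_continuous_image compact_imp_bounded by blast
  then obtain B where B: "\<And>x. x \<in> S \<Longrightarrow> \<bar>T x\<bar> \<le> B"
    by (auto simp: bounded_iff)
  have expand: "F v = (\<Sum>i\<in>Basis. (v \<bullet> i) * F i)" if "linear F" for F :: "'v \<Rightarrow> real" and v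
    by (subst euclidean_representation[of v, symmetric])
      (simp add: linear_sum[OF that] linear_cmul[OF that] del: euclidean_representation)
  have "G x v v \<le> \<epsilon>\<^sup>2 * \<bar>B\<bar>" if x: "x \<in> S" and v: "norm v \<le> \<epsilon>" for x v
  proof -
    have lin: "linear (G x u)" "linear (\<lambda>w. G x w u)" for u
      using G by (auto simp: riemannian_metric_def bilinear_def)
    have "G x v v = (\<Sum>i\<in>Basis. (v \<bullet> i) * (\<Sum>j\<in>Basis. (v \<bullet> j) * G x i j))"
      by (subst expand[OF lin(2)], rule sum.cong[OF HOL.refl], subst expand[OF lin(1)]) simp
    also have "\<dots> = (\<Sum>i\<in>Basis. \<Sum>j\<in>Basis. (v \<bullet> i) * (v \<bullet> j) * G x i j)"
      by (simp add: sum_distrib_left mult.assoc)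
    also have "\<dots> \<le> (\<Sum>i\<in>Basis. \<Sum>j\<in>Basis. \<epsilon>\<^sup>2 * \<bar>G x i j\<bar>)"
    proof (intro sum_mono)
      fix i j :: 'v assume "i \<in> Basis" "j \<in> Basis"
      then have "\<bar>v \<bullet> i\<bar> \<le> \<epsilon>" "\<bar>v \<bullet> j\<bar> \<le> \<epsilon>"
        using v Basis_le_norm order_trans by blast+
      then have "\<bar>v \<bullet> i\<bar> * \<bar>v \<bullet> j\<bar> \<le> \<epsilon> * \<epsilon>"
        by (intro mult_mono) auto
      then have "\<bar>v \<bullet> i\<bar> * \<bar>v \<bullet> j\<bar> * \<bar>G x i j\<bar> \<le> \<epsilon>\<^sup>2 * \<bar>G x i j\<bar>"
        by (intro mult_right_mono) (auto simp: power2_eq_square)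
      then show "(v \<bullet> i) * (v \<bullet> j) * G x i j \<le> \<epsilon>\<^sup>2 * \<bar>G x i j\<bar>"
        using abs_ge_self[of "(v \<bullet> i) * (v \<bullet> j) * G x i j"] by (simp add: abs_mult)
    qed
    also have "\<dots> = \<epsilon>\<^sup>2 * T x"
      by (simp add: T_def sum_distrib_left)
    also have "\<dots> \<le> \<epsilon>\<^sup>2 * \<bar>B\<bar>"
      using B[OF x] by (intro mult_left_mono) auto
    finally show ?thesis .
  qed
  then show ?thesis
    by (intro that[of "sqrt (\<epsilon>\<^sup>2 * \<bar>B\<bar>)"]) (auto intro: real_sqrt_le_mono)
qed

lemma lifted_path_endpoints:
  assumes "lifted_path X p g x y l"
  shows "x \<in> topspace X" and "y \<in> topspace X"
  using assms by (induction) (auto simp: pathin_def continuous_map_def)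

lemma lifted_path_trans:
  assumes "lifted_path X p g y z l'" and "lifted_path X p g x y l"
  shows "lifted_path X p g x z (l + l')"
  using assms
proof (induction)
  case (step x' \<gamma> l' S c)
  then show ?case
    using lifted_path.step[of X p g x \<gamma> "l + l'" S c] by (simp add: add.assoc)
qed simp

lemma lifted_path_piece:
  assumes "pathin X \<gamma>" and "S \<in> cells g" and "c C1_differentiable_on {0..1}"
    and "\<forall>t\<in>{0..1}. c t \<in> S \<and> p (\<gamma> t) = param g (c t)"
  shows "lifted_path X p g (\<gamma> 0) (\<gamma> 1) (integral {0..1}
    (\<lambda>t. sqrt (gtensor g S (c t) (vector_derivative c (at t)) (vector_derivative c (at t)))))"
proof -
  have "\<gamma> 0 \<in> topspace X"
    using assms(1) by (auto simp: pathin_def continuous_map_def)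
  then show ?thesis
    using lifted_path.step[OF lifted_path.refl assms] by simp
qed

lemma lifted_path_sym:
  assumes "lifted_path X p g x y l"
    and G: "\<And>S. S \<in> cells g \<Longrightarrow> riemannian_metric (gtensor g S)"
  shows "lifted_path X p g y x l"
  using assms(1)
proof (induction)
  case (refl x)
  then show ?case by (rule lifted_path.refl)
next
  case (step x \<gamma> l S c)
  let ?\<phi> = "\<lambda>c t. sqrt (gtensor g S (c t) (vector_derivative c (at t)) (vector_derivative c (at t)))"
  let ?rc = "\<lambda>t. c (1 - t)" and ?r\<gamma> = "\<lambda>t. \<gamma> (1 - t)"
  obtain D where "\<forall>t\<in>{0..1}. (c has_vector_derivative D t) (at t)" and contD: "continuous_on {0..1} D"
    using step.hyps unfolding C1_differentiable_on_def by blast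
  then have D: "(c has_vector_derivative D t) (at t)" if "t \<in> {0..1}" for t
    using that by blast
  have rD: "(?rc has_vector_derivative - D (1 - t)) (at t)" if "t \<in> {0..1}" for t
  proof -
    have "((\<lambda>t. 1 - t) has_vector_derivative - 1) (at t)"
      by (auto intro!: derivative_eq_intros)
    from vector_diff_chain_at[OF this, of c "D (1 - t)"] D[of "1 - t"] that show ?thesis
      by (simp add: o_def)
  qed
  have "?rc C1_differentiable_on {0..1}"
    unfolding C1_differentiable_on_def
    by (intro exI[of _ "\<lambda>t. - D (1 - t)"] conjI ballI rD continuous_intros
        continuous_on_compose2[OF contD]) auto
  moreover have "pathin X ?r\<gamma>"
  proof -
    have "continuous_on {0..1} (\<lambda>t::real. 1 - t)"
      by (intro continuous_intros)
    then have "continuous_map (top_of_set {0..1}) (top_of_set {0..1}) (\<lambda>t::real. 1 - t)"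
      by auto
    from continuous_map_compose[OF this step.hyps(2)[unfolded pathin_def]] show ?thesis
      by (simp add: pathin_def o_def)
  qed
  ultimately have "lifted_path X p g (?r\<gamma> 0) (?r\<gamma> 1) (integral {0..1} (?\<phi> ?rc))"
    using step.hyps by (intro lifted_path_piece) auto
  moreover have "integral {0..1} (?\<phi> ?rc) = integral {0..1} (\<lambda>t. ?\<phi> c (1 - t))"
  proof (rule integral_cong)
    fix t :: real assume t: "t \<in> {0..1}"
    have "bilinear (gtensor g S (c (1 - t)))"
      using G[OF \<open>S \<in> cells g\<close>] unfolding riemannian_metric_def by blast
    then show "?\<phi> ?rc t = ?\<phi> c (1 - t)"
      using vector_derivative_at[OF rD[OF t]] vector_derivative_at[OF D[of "1 - t"]] t
      by (simp add: bilinear_lneg bilinear_rneg)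
  qed
  ultimately have "lifted_path X p g (\<gamma> 1) (\<gamma> 0) (integral {0..1} (?\<phi> c))"
    using integral_reverse_unit_interval[of "?\<phi> c"] by simp
  from lifted_path_trans[OF step.IH this] show ?case
    by (simp add: add.commute)
qed

lemma lifted_path_nonneg:
  assumes "lifted_path X p g x y l"
    and G: "\<And>S. S \<in> cells g \<Longrightarrow> riemannian_metric (gtensor g S)"
  shows "0 \<le> l"
  using assms(1)
proof (induction)
  case (step x \<gamma> l S c)
  then show ?case
    using riemannian_metric_nonneg[OF G[OF \<open>S \<in> cells g\<close>]]
    by (intro add_nonneg_nonneg integral_unit_interval_bounds(1)) (simp_all only: real_sqrt_ge_zero)
qed simp

text \<open>Let \<open>q\<close> be the point of the triangulation under \<open>x\<close>. A small ball around \<open>q\<close> lies over an evenly covered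
  set and avoids all simplices that do not contain \<open>q\<close>. A point \<open>y\<close> of this ball therefore shares a simplex
  with \<open>q\<close>, and by convexity the segment from \<open>q\<close> to \<open>y\<close> stays in that simplex and in the ball; it lifts
  through the sheet containing \<open>x\<close>. The lengths of these segments are bounded because there
  are only finitely many simplices.\<close>

lemma lifted_path_locally_bounded:
  assumes g: "polyhedral_metric M A g" and cov: "covering_map X M p" and x: "x \<in> topspace X"
  obtains W C where "openin X W" and "x \<in> W" and "\<And>y. y \<in> W \<Longrightarrow> \<exists>l\<le>C. lifted_path X p g x y l"
proof -
  let ?P = "\<Union>(cells g)" and ?h = "param g"
  have K: "simplicial_complex (cells g)" and h: "homeomorphic_map (top_of_set ?P) M ?h"
    and G: "\<And>S. S \<in> cells g \<Longrightarrow> riemannian_metric (gtensor g S)"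
    using g by (auto simp: polyhedral_metric_def smooth_triangulation_def)
  have fin: "finite (cells g)"
    using K by (simp add: simplicial_complex_def)
  have simplices: "compact S" "convex S" if "S \<in> cells g" for S
    using K that by (auto simp: simplicial_complex_def compact_simplex convex_simplex)
  obtain k where hk: "homeomorphic_maps (top_of_set ?P) M ?h k"
    using h homeomorphic_map_maps by blast
  then have k: "continuous_map M (top_of_set ?P) k" and ch: "continuous_map (top_of_set ?P) M ?h"
    and h_k: "\<And>m. m \<in> topspace M \<Longrightarrow> ?h (k m) = m"
    by (auto simp: homeomorphic_maps_def)
  have p: "continuous_map X M p"
    using cov by (simp add: covering_map_def)
  then have px: "p y \<in> topspace M" if "y \<in> topspace X" for y
    using that by (auto simp: continuous_map_def)
  have kP: "k m \<in> ?P" if "m \<in> topspace M" for m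
    using k that by (fastforce simp: continuous_map_def)
  obtain V \<U> where V: "openin M V" "p x \<in> V" and \<U>: "\<Union>\<U> = {y \<in> topspace X. p y \<in> V}"
    "\<forall>U\<in>\<U>. openin X U \<and> homeomorphic_map (subtopology X U) (subtopology M V) p"
    using bspec[OF conjunct2[OF conjunct2[OF cov[unfolded covering_map_def]]] px[OF x]]
    by (elim exE conjE)
  obtain U where U: "openin X U" "x \<in> U" and "homeomorphic_map (subtopology X U) (subtopology M V) p"
    using \<U> x V(2) by blast
  then obtain s where "homeomorphic_maps (subtopology X U) (subtopology M V) p s"
    using homeomorphic_map_maps by blast
  then have s: "continuous_map (subtopology M V) (subtopology X U) s"
    and s_p: "\<And>y. y \<in> U \<Longrightarrow> s (p y) = y" and p_s: "\<And>m. m \<in> V \<Longrightarrow> p (s m) = m"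
    using openin_subset[OF U(1)] openin_subset[OF V(1)] by (auto simp: homeomorphic_maps_def Int_absorb1)
  define q where "q = k (p x)"
  have q: "q \<in> ?P" "?h q = p x"
    using kP h_k px[OF x] by (auto simp: q_def)
  have "openin (top_of_set ?P) {y \<in> ?P. ?h y \<in> V}"
    using openin_continuous_map_preimage[OF ch V(1)] by simp
  then obtain T where T: "open T" "{y \<in> ?P. ?h y \<in> V} = ?P \<inter> T"
    by (auto simp: openin_open)
  \<comment> \<open>The union of the simplices that do not contain \<open>q\<close>.\<close>
  define E where "E = \<Union>{S \<in> cells g. q \<notin> S}"
  have "closed E"
    using fin simplices by (auto simp: E_def intro!: closed_Union compact_imp_closed)
  then have "open (T - E)"
    using T(1) by (simp add: open_Diff)
  moreover have "q \<in> T - E"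
    using q V(2) T(2) by (auto simp: E_def)
  ultimately obtain \<epsilon> where \<epsilon>: "\<epsilon> > 0" "ball q \<epsilon> \<subseteq> T - E"
    using openE by blast
  have "\<exists>C. C \<ge> 0 \<and> (\<forall>y v. y \<in> S \<and> norm v \<le> \<epsilon> \<longrightarrow> sqrt (gtensor g S y v v) \<le> C)" if "S \<in> cells g" for S
    using riemannian_metric_bounded_on_compact[OF G[OF that] simplices(1)[OF that]] by metis
  then obtain C where C: "\<And>S. S \<in> cells g \<Longrightarrow> C S \<ge> 0"
    "\<And>S y v. \<lbrakk>S \<in> cells g; y \<in> S; norm v \<le> \<epsilon>\<rbrakk> \<Longrightarrow> sqrt (gtensor g S y v v) \<le> C S"
    by metis
  define W where "W = U \<inter> {y \<in> topspace X. (k \<circ> p) y \<in> ball q \<epsilon>}"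
  show ?thesis
  proof
    have "continuous_map X (top_of_set ?P) (k \<circ> p)"
      by (rule continuous_map_compose[OF p k])
    then have "continuous_map X euclidean (k \<circ> p)"
      by (simp add: continuous_map_in_subtopology)
    then have "openin X {y \<in> topspace X. (k \<circ> p) y \<in> ball q \<epsilon>}"
      by (rule openin_continuous_map_preimage) auto
    then show "openin X W"
      using U(1) by (simp add: W_def openin_Int)
    show "x \<in> W"
      using U(2) x \<epsilon>(1) by (simp add: W_def q_def)
    fix x' assume "x' \<in> W"
    then have x': "x' \<in> U" "x' \<in> topspace X" and y_ball: "k (p x') \<in> ball q \<epsilon>"
      by (auto simp: W_def)
    define y where "y = k (p x')"
    have y: "y \<in> ?P" "?h y = p x'"
      using kP h_k px[OF x'(2)] by (auto simp: y_def)
    then obtain S where S: "S \<in> cells g" "y \<in> S"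
      by blast
    have "q \<in> S"
      using S y_ball \<epsilon>(2) by (auto simp: E_def y_def)
    define c where "c t = q + t *\<^sub>R (y - q)" for t
    have c_conv: "c t = (1 - t) *\<^sub>R q + t *\<^sub>R y" for t
      by (simp add: c_def algebra_simps)
    have cS: "c t \<in> S" and cT: "c t \<in> T" if "t \<in> {0..1}" for t
    proof -
      show "c t \<in> S"
        using convexD_alt[OF simplices(2)[OF S(1)] \<open>q \<in> S\<close> S(2)] that by (simp add: c_conv)
      have "c t \<in> ball q \<epsilon>"
        using convexD_alt[OF convex_ball, of q q \<epsilon> y t] y_ball \<epsilon>(1) that by (simp add: c_conv y_def)
      then show "c t \<in> T"
        using \<epsilon>(2) by blast
    qed
    have cV: "?h (c t) \<in> V" if "t \<in> {0..1}" for t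
      using T(2) cS[OF that] cT[OF that] S(1) by blast
    have cder: "(c has_vector_derivative (y - q)) (at t)" for t
      unfolding c_def by (auto intro!: derivative_eq_intros)
    have c_cont: "continuous_on A c" for A
      unfolding c_def by (intro continuous_intros)
    define \<gamma> where "\<gamma> = s \<circ> (?h \<circ> c)"
    have "continuous_map (top_of_set {0..1}) (top_of_set ?P) c"
      using c_cont cS S(1) by auto
    then have "continuous_map (top_of_set {0..1}) M (?h \<circ> c)"
      by (rule continuous_map_compose[OF _ ch])
    then have "continuous_map (top_of_set {0..1}) (subtopology M V) (?h \<circ> c)"
      using cV by (auto simp: continuous_map_in_subtopology)
    from continuous_map_compose[OF this s] have "pathin X \<gamma>"
      by (simp add: pathin_def \<gamma>_def continuous_map_in_subtopology)
    moreover have "c C1_differentiable_on {0..1}"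
      unfolding C1_differentiable_on_def
      by (intro exI[of _ "\<lambda>_. y - q"] conjI ballI cder continuous_on_const)
    moreover have "\<forall>t\<in>{0..1}. c t \<in> S \<and> p (\<gamma> t) = ?h (c t)"
      using cS p_s cV by (simp add: \<gamma>_def)
    ultimately have "lifted_path X p g (\<gamma> 0) (\<gamma> 1) (integral {0..1}
        (\<lambda>t. sqrt (gtensor g S (c t) (vector_derivative c (at t)) (vector_derivative c (at t)))))"
      by (intro lifted_path_piece S(1))
    moreover have "\<gamma> 0 = x" "\<gamma> 1 = x'"
      using q(2) y(2) s_p U(2) x'(1) by (auto simp: \<gamma>_def c_def)
    moreover have "integral {0..1}
        (\<lambda>t. sqrt (gtensor g S (c t) (vector_derivative c (at t)) (vector_derivative c (at t)))) \<le> C S"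
      using y_ball C S(1) cS G[OF S(1)]
      by (intro integral_unit_interval_bounds)
        (auto simp: vector_derivative_at[OF cder] y_def dist_norm norm_minus_commute riemannian_metric_nonneg)
    moreover have "C S \<le> (\<Sum>S\<in>cells g. C S)"
      using fin S(1) C(1) by (intro member_le_sum) auto
    ultimately show "\<exists>l\<le>(\<Sum>S\<in>cells g. C S). lifted_path X p g x x' l"
      by (intro exI conjI) (rule order_trans, assumption+, simp)
  qed
qed

text \<open>By the previous lemma the set of points that can be reached from \<open>x\<close>, as well as its complement, is
  open. Consequently the infimum in the definition of the lifted distance is never taken over
  an empty set.\<close>

lemma lifted_path_exists:
  assumes g: "polyhedral_metric M A g" and cov: "connected_covering X M p"
    and x: "x \<in> topspace X" and y: "y \<in> topspace X"
  shows "\<exists>l. lifted_path X p g x y l"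
proof -
  have G: "\<And>S. S \<in> cells g \<Longrightarrow> riemannian_metric (gtensor g S)"
    using g by (auto simp: polyhedral_metric_def)
  have conn: "connected_space X" and "covering_map X M p"
    using cov by (auto simp: connected_covering_def)
  note local = lifted_path_locally_bounded[OF g this(2)]
  define R where "R = {y. \<exists>l. lifted_path X p g x y l}"
  have R: "R \<subseteq> topspace X"
    using lifted_path_endpoints(2) by (auto simp: R_def)
  have "openin X R"
  proof (subst openin_subopen, intro ballI)
    fix y assume "y \<in> R"
    then obtain W C where W: "openin X W" "y \<in> W" "\<And>w. w \<in> W \<Longrightarrow> \<exists>l\<le>C. lifted_path X p g y w l"
      using local R by (metis subsetD)
    obtain l where l: "lifted_path X p g x y l"
      using \<open>y \<in> R\<close> by (auto simp: R_def)
    have "W \<subseteq> R"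
      using W(3) lifted_path_trans[OF _ l] by (fastforce simp: R_def)
    then show "\<exists>W. openin X W \<and> y \<in> W \<and> W \<subseteq> R"
      using W by blast
  qed
  moreover have "openin X (topspace X - R)"
  proof (subst openin_subopen, intro ballI)
    fix y assume y: "y \<in> topspace X - R"
    then obtain W C where W: "openin X W" "y \<in> W" "\<And>w. w \<in> W \<Longrightarrow> \<exists>l\<le>C. lifted_path X p g y w l"
      using local by (metis DiffD1)
    have disj: "w \<notin> R" if "w \<in> W" for w
    proof
      assume "w \<in> R"
      then obtain l where l: "lifted_path X p g x w l"
        by (auto simp: R_def)
      obtain l' where "lifted_path X p g y w l'"
        using W(3)[OF \<open>w \<in> W\<close>] by blast
      then have "lifted_path X p g w y l'"
        by (rule lifted_path_sym) (rule G)
      from lifted_path_trans[OF this l] show False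
        using y by (auto simp: R_def)
    qed
    have "W \<subseteq> topspace X - R"
      using openin_subset[OF W(1)] disj by auto
    then show "\<exists>W. openin X W \<and> y \<in> W \<and> W \<subseteq> topspace X - R"
      using W(1,2) by (intro exI conjI)
  qed
  moreover have "x \<in> R"
    using lifted_path.refl[OF x] by (auto simp: R_def)
  ultimately have "openin X R \<and> closedin X R" and "R \<noteq> {}"
    using R by (auto simp only: closedin_def)
  then have "R = topspace X"
    using conn unfolding connected_space_clopen_in by blast
  then show ?thesis
    using y by (auto simp: R_def)
qed

lemma lifted_dist_le:
  assumes g: "polyhedral_metric M A g" and l: "lifted_path X p g x y l"
  shows "lifted_dist X p g x y \<le> l"
proof -
  have "bdd_below {l. lifted_path X p g x y l}"
    using g by (intro bdd_belowI[of _ 0]) (auto simp: polyhedral_metric_def intro: lifted_path_nonneg)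
  then show ?thesis
    using l lifted_path_endpoints[OF l] by (auto simp: lifted_dist_def intro: cInf_lower)
qed

lemma lifted_dist_nonneg:
  assumes g: "polyhedral_metric M A g" and cov: "connected_covering X M p"
  shows "0 \<le> lifted_dist X p g x y"
proof (cases "x \<in> topspace X \<and> y \<in> topspace X")
  case True
  have "0 \<le> l" if "lifted_path X p g x y l" for l
    using lifted_path_nonneg[OF that] g by (auto simp: polyhedral_metric_def)
  then have "0 \<le> Inf {l. lifted_path X p g x y l}"
    using lifted_path_exists[OF g cov, of x y] True by (intro cInf_greatest) auto
  then show ?thesis
    using True by (simp add: lifted_dist_def)
next
  case False
  then show ?thesis
    unfolding lifted_dist_def by (simp only: if_False order.refl)
qed

lemma lifted_dist_triangle:
  assumes g: "polyhedral_metric M A g" and cov: "connected_covering X M p"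
    and xyz: "x \<in> topspace X" "y \<in> topspace X" "z \<in> topspace X"
  shows "lifted_dist X p g x z \<le> lifted_dist X p g x y + lifted_dist X p g y z"
proof -
  have "lifted_dist X p g x z - l \<le> lifted_dist X p g y z" if l: "lifted_path X p g x y l" for l
  proof -
    have "lifted_dist X p g x z - l \<le> l'" if "lifted_path X p g y z l'" for l'
      using lifted_dist_le[OF g lifted_path_trans[OF that l]] by simp
    then have "lifted_dist X p g x z - l \<le> Inf {l'. lifted_path X p g y z l'}"
      using lifted_path_exists[OF g cov xyz(2,3)] by (intro cInf_greatest) auto
    then show ?thesis
      using xyz by (simp add: lifted_dist_def[of X p g y z])
  qed
  then have "lifted_dist X p g x z - lifted_dist X p g y z \<le> l" if "lifted_path X p g x y l" for l
    using that by force
  then have "lifted_dist X p g x z - lifted_dist X p g y z \<le> Inf {l. lifted_path X p g x y l}"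
    using lifted_path_exists[OF g cov xyz(1,2)] by (intro cInf_greatest) auto
  then show ?thesis
    using xyz by (simp add: lifted_dist_def[of X p g x y])
qed

lemma lifted_dist_sym:
  assumes g: "polyhedral_metric M A g"
  shows "lifted_dist X p g x y = lifted_dist X p g y x"
proof -
  have "lifted_path X p g x y = lifted_path X p g y x"
    using g by (intro ext iffI) (auto simp: polyhedral_metric_def intro: lifted_path_sym)
  then show ?thesis
    by (auto simp: lifted_dist_def)
qed

lemma lifted_dist_self:
  assumes g: "polyhedral_metric M A g" and cov: "connected_covering X M p" and x: "x \<in> topspace X"
  shows "lifted_dist X p g x x = 0"
proof (rule antisym)
  show "lifted_dist X p g x x \<le> 0"
    by (rule lifted_dist_le[OF g lifted_path.refl[OF x]])
  show "0 \<le> lifted_dist X p g x x"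
    by (rule lifted_dist_nonneg[OF g cov])
qed

lemma pseudometric_lifted_dist:
  assumes "polyhedral_metric M A g" and "connected_covering X M p"
  shows "pseudometric_on (topspace X) (lifted_dist X p g)"
proof
  show "0 \<le> lifted_dist X p g x y" for x y
    by (rule lifted_dist_nonneg[OF assms])
  show "lifted_dist X p g x y = lifted_dist X p g y x" for x y
    by (rule lifted_dist_sym[OF assms(1)])
  show "lifted_dist X p g x x = 0" if "x \<in> topspace X" for x
    by (rule lifted_dist_self[OF assms that])
  show "lifted_dist X p g x z \<le> lifted_dist X p g x y + lifted_dist X p g y z"
    if "x \<in> topspace X" "y \<in> topspace X" "z \<in> topspace X" for x y z
    by (rule lifted_dist_triangle[OF assms that])
qed

text \<open>A chain is locally finite with respect to bounded sets, while almost proper maps are constant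
  outside compact sets; this is the link between the two.\<close>

lemma lifted_dist_bounded_on_compact:
  assumes g: "polyhedral_metric M A g" and cov: "connected_covering X M p"
    and K: "compactin X K" and x0: "x0 \<in> topspace X"
  shows "\<exists>C. \<forall>y\<in>K. lifted_dist X p g x0 y \<le> C"
proof -
  have cov': "covering_map X M p"
    using cov by (simp add: connected_covering_def)
  define \<W> where "\<W> = {W. openin X W \<and> (\<exists>C. \<forall>y\<in>W. lifted_dist X p g x0 y \<le> C)}"
  have "\<exists>W\<in>\<W>. x \<in> W" if x: "x \<in> topspace X" for x
  proof -
    obtain W C where W: "openin X W" "x \<in> W" "\<And>y. y \<in> W \<Longrightarrow> \<exists>l\<le>C. lifted_path X p g x y l"
      using lifted_path_locally_bounded[OF g cov' x] by blast
    have "lifted_dist X p g x0 y \<le> lifted_dist X p g x0 x + C" if "y \<in> W" for y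
    proof -
      have "y \<in> topspace X"
        using that openin_subset[OF W(1)] by blast
      then have "lifted_dist X p g x0 y \<le> lifted_dist X p g x0 x + lifted_dist X p g x y"
        by (rule lifted_dist_triangle[OF g cov x0 x])
      moreover have "lifted_dist X p g x y \<le> C"
      proof -
        obtain l where "l \<le> C" "lifted_path X p g x y l"
          using W(3)[OF \<open>y \<in> W\<close>] by blast
        then show ?thesis
          using lifted_dist_le[OF g, of X p x y l] by linarith
      qed
      ultimately show ?thesis
        by simp
    qed
    then show ?thesis
      using W(1,2) unfolding \<W>_def by blast
  qed
  moreover have "K \<subseteq> topspace X"
    using K by (rule compactin_subset_topspace)
  ultimately have "K \<subseteq> \<Union>\<W>"
    by blast
  then obtain \<F> where \<F>: "finite \<F>" "\<F> \<subseteq> \<W>" "K \<subseteq> \<Union>\<F>"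
    using compactinD[OF K, of \<W>] by (auto simp: \<W>_def)
  then have "\<forall>W\<in>\<F>. \<exists>C. \<forall>y\<in>W. lifted_dist X p g x0 y \<le> C"
    by (auto simp: \<W>_def)
  then obtain C where C: "\<And>W y. W \<in> \<F> \<Longrightarrow> y \<in> W \<Longrightarrow> lifted_dist X p g x0 y \<le> C W"
    by metis
  have "lifted_dist X p g x0 y \<le> (\<Sum>W\<in>\<F>. \<bar>C W\<bar>)" if "y \<in> K" for y
  proof -
    obtain W where W: "W \<in> \<F>" "y \<in> W"
      using \<F>(3) \<open>y \<in> K\<close> by blast
    have "\<bar>C W\<bar> \<le> (\<Sum>W\<in>\<F>. \<bar>C W\<bar>)"
      using \<F>(1) W(1) by (intro member_le_sum) auto
    then show ?thesis
      using C[OF W] by linarith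
  qed
  then show ?thesis
    by blast
qed

section \<open>Sphere-valued extensions over a neighbourhood of the Kuratowski image\<close>

text \<open>Adding the discrete metric, which is \<open>1\<close> off the diagonal, turns a pseudometric into a metric.
  Both stay at bounded distance from each other, so they define the same space \<open>L\<^sup>\<infinity>(X)\<^sub>b\<close>.\<close>

lemma Metric_space_linf_pseudometric:
  assumes "pseudometric_on (topspace X) d"
  shows "Metric_space (linf_b X d) (linf_dist X d)"
proof -
  interpret pseudometric_on "topspace X" d by fact
  define d' where "d' = (\<lambda>x y. d x y + (if x = y then 0 else 1))"
  have "Metric_space (topspace X) d'"
  proof
    show "d' x z \<le> d' x y + d' y z" if "x \<in> topspace X" "y \<in> topspace X" "z \<in> topspace X" for x y z
      using triangle[OF that] by (auto simp: d'_def)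
    show "(d' x y = 0) = (x = y)" if "x \<in> topspace X" "y \<in> topspace X" for x y
      using nonneg[of x y] self[OF that(1)] by (auto simp: d'_def)
  qed (auto simp: d'_def nonneg sym)
  moreover have "bounded ((\<lambda>y. u y - d' x y) ` A) \<longleftrightarrow> bounded ((\<lambda>y. u y - d x y) ` A)" for u x A
  proof -
    have close: "\<bar>(u y - d' x y) - (u y - d x y)\<bar> \<le> 1" for y
      by (auto simp: d'_def)
    have "bounded (g ` A)" if "bounded (h ` A)" "\<And>y. \<bar>g y - h y\<bar> \<le> 1" for g h :: "'a \<Rightarrow> real"
    proof -
      obtain C where C: "\<And>y. y \<in> A \<Longrightarrow> \<bar>h y\<bar> \<le> C"
        using \<open>bounded (h ` A)\<close> by (auto simp: bounded_iff)
      have "\<bar>g y\<bar> \<le> C + 1" if "y \<in> A" for y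
        using C[OF that] that(1) \<open>\<bar>g y - h y\<bar> \<le> 1\<close> by linarith
      then show ?thesis
        by (auto simp: bounded_iff)
    qed
    from this[of "\<lambda>y. u y - d x y" "\<lambda>y. u y - d' x y"] this[of "\<lambda>y. u y - d' x y" "\<lambda>y. u y - d x y"]
    show ?thesis
      using close by (auto simp only: abs_minus_commute)
  qed
  then have "linf_b X d' = linf_b X d"
    by (simp add: linf_b_def)
  moreover from this have "linf_dist X d' = linf_dist X d"
    by (intro ext) (simp add: linf_dist_def)
  ultimately show ?thesis
    using Metric_space_linf[of X d'] by simp
qed

lemma (in pseudometric_on) kuratowski_isometry:
  assumes S: "S = topspace X" and x: "x \<in> S" and y: "y \<in> S"
  shows kuratowski_in_linf_b: "kuratowski X d x \<in> linf_b X d"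
    and linf_dist_kuratowski: "linf_dist X d (kuratowski X d x) (kuratowski X d y) = d x y"
proof -
  have mem: "kuratowski X d v \<in> linf_b X d" if "v \<in> S" for v
  proof -
    have "(\<lambda>w. kuratowski X d v w - d v w) ` topspace X = (\<lambda>w. 0) ` topspace X"
      by (auto simp: kuratowski_def image_iff)
    then have "bounded ((\<lambda>w. kuratowski X d v w - d v w) ` topspace X)"
      by (simp add: finite_imp_bounded image_constant_conv)
    then show ?thesis
      using that S by (auto simp: linf_b_def kuratowski_def intro!: bexI[of _ v])
  qed
  have "(SUP w\<in>topspace X. \<bar>kuratowski X d x w - kuratowski X d y w\<bar>) = d x y"
  proof (rule cSup_eq_maximum)
    show "d x y \<in> (\<lambda>w. \<bar>kuratowski X d x w - kuratowski X d y w\<bar>) ` topspace X"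
      using x y S self[OF y] nonneg[of x y] by (intro image_eqI[of _ _ y]) (auto simp: kuratowski_def)
    fix t assume "t \<in> (\<lambda>w. \<bar>kuratowski X d x w - kuratowski X d y w\<bar>) ` topspace X"
    then obtain w where "w \<in> S" "t = \<bar>d x w - d y w\<bar>"
      using S by (auto simp: kuratowski_def)
    then show "t \<le> d x y"
      using triangle[OF x y, of w] triangle[OF y x, of w] sym[of x y] by auto
  qed
  then show "kuratowski X d x \<in> linf_b X d"
      "linf_dist X d (kuratowski X d x) (kuratowski X d y) = d x y"
    using mem x y by (auto simp: linf_dist_def)
qed

text \<open>McShane's formula \<open>H u = inf\<^sub>x (h x + D u (j x))\<close> gives the largest \<open>1\<close>-Lipschitz function that
  agrees with \<open>h\<close> along \<open>j\<close>. The points \<open>j x\<close> need not be distinct, since the Lipschitz condition on \<open>h\<close> is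
  with respect to the distance of the images.\<close>

lemma McShane_extension:
  fixes h :: "'x \<Rightarrow> real" and D :: "'m \<Rightarrow> 'm \<Rightarrow> real"
  assumes "Metric_space M D" and ne: "X \<noteq> {}" and j: "\<And>x. x \<in> X \<Longrightarrow> j x \<in> M"
    and h: "\<And>x y. \<lbrakk>x \<in> X; y \<in> X\<rbrakk> \<Longrightarrow> \<bar>h x - h y\<bar> \<le> D (j x) (j y)"
  obtains H where "\<And>x. x \<in> X \<Longrightarrow> H (j x) = h x"
    and "\<And>u v. \<lbrakk>u \<in> M; v \<in> M\<rbrakk> \<Longrightarrow> \<bar>H u - H v\<bar> \<le> D u v"
proof -
  interpret Metric_space M D by fact
  define H where "H u = (INF x\<in>X. h x + D u (j x))" for u
  have lower: "h a - D u (j a) \<le> h x + D u (j x)" if "a \<in> X" "x \<in> X" "u \<in> M" for a x u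
    using h[OF that(1,2)] triangle[OF j[OF that(1)] that(3) j[OF that(2)]] commute[of u "j a"]
    by linarith
  have le: "H u \<le> h x + D u (j x)" if "u \<in> M" "x \<in> X" for u x
    unfolding H_def using that lower[OF that(2) _ that(1)]
    by (intro cINF_lower bdd_belowI2[of _ "h x - D u (j x)"]) auto
  have "H u - H v \<le> D u v" if "u \<in> M" "v \<in> M" for u v
  proof -
    have "H u - D u v \<le> H v"
      unfolding H_def[of v]
    proof (rule cINF_greatest[OF ne])
      fix x assume "x \<in> X"
      then show "H u - D u v \<le> h x + D v (j x)"
        using le[OF that(1), of x] triangle[OF that j[of x]] by simp
    qed
    then show ?thesis
      by simp
  qed
  then have "\<bar>H u - H v\<bar> \<le> D u v" if "u \<in> M" "v \<in> M" for u v
    using that commute by (metis abs_diff_le_iff diff_le_eq add.commute)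
  moreover have "H (j x) = h x" if "x \<in> X" for x
  proof (rule antisym)
    show "H (j x) \<le> h x"
      using le[OF j[OF that] that] j[OF that] by simp
    show "h x \<le> H (j x)"
      unfolding H_def using h[OF that] by (intro cINF_greatest[OF ne]) force
  qed
  ultimately show ?thesis
    using that by blast
qed

text \<open>Extending all coordinates separately costs at most the factor \<open>DIM('v)\<close> in the Lipschitz constant,
  by comparison of the Euclidean norm with the sum of the coordinates.\<close>

lemma McShane_extension_euclidean:
  fixes f :: "'x \<Rightarrow> 'v::euclidean_space" and D :: "'m \<Rightarrow> 'm \<Rightarrow> real"
  assumes M: "Metric_space M D" and ne: "X \<noteq> {}" and j: "\<And>x. x \<in> X \<Longrightarrow> j x \<in> M"
    and f: "\<And>x y. \<lbrakk>x \<in> X; y \<in> X\<rbrakk> \<Longrightarrow> norm (f x - f y) \<le> D (j x) (j y)"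
  obtains F where "\<And>x. x \<in> X \<Longrightarrow> F (j x) = f x"
    and "\<And>u v. \<lbrakk>u \<in> M; v \<in> M\<rbrakk> \<Longrightarrow> norm (F u - F v) \<le> DIM('v) * D u v"
proof -
  have "\<exists>H. (\<forall>x\<in>X. H (j x) = f x \<bullet> b) \<and> (\<forall>u\<in>M. \<forall>v\<in>M. \<bar>H u - H v\<bar> \<le> D u v)" if "b \<in> Basis" for b
  proof -
    have lip: "\<bar>f x \<bullet> b - f y \<bullet> b\<bar> \<le> D (j x) (j y)" if "x \<in> X" "y \<in> X" for x y
      using f[OF that] Basis_le_norm[OF \<open>b \<in> Basis\<close>, of "f x - f y"] by (simp add: inner_diff_left)
    show ?thesis
    proof (rule McShane_extension[OF M ne, where j = j and h = "\<lambda>x. f x \<bullet> b"])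
      fix H assume "\<And>x. x \<in> X \<Longrightarrow> H (j x) = f x \<bullet> b" "\<And>u v. \<lbrakk>u \<in> M; v \<in> M\<rbrakk> \<Longrightarrow> \<bar>H u - H v\<bar> \<le> D u v"
      then show ?thesis
        by (intro exI[of _ H]) simp
    qed (use j lip in simp_all)
  qed
  then obtain H where "\<forall>b\<in>Basis. (\<forall>x\<in>X. H b (j x) = f x \<bullet> b) \<and> (\<forall>u\<in>M. \<forall>v\<in>M. \<bar>H b u - H b v\<bar> \<le> D u v)"
    using bchoice[of "Basis :: 'v set" "\<lambda>b H. (\<forall>x\<in>X. H (j x) = f x \<bullet> b) \<and> (\<forall>u\<in>M. \<forall>v\<in>M. \<bar>H u - H v\<bar> \<le> D u v)"]
    by blast
  then have H: "\<And>b x. b \<in> Basis \<Longrightarrow> x \<in> X \<Longrightarrow> H b (j x) = f x \<bullet> b"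
    "\<And>b u v. b \<in> Basis \<Longrightarrow> u \<in> M \<Longrightarrow> v \<in> M \<Longrightarrow> \<bar>H b u - H b v\<bar> \<le> D u v"
    by simp_all
  show ?thesis
  proof
    fix x assume "x \<in> X"
    then show "(\<Sum>b\<in>Basis. H b (j x) *\<^sub>R b) = f x"
      by (simp add: H(1) euclidean_representation)
  next
    fix u v assume uv: "u \<in> M" "v \<in> M"
    have "norm ((\<Sum>b\<in>Basis. H b u *\<^sub>R b) - (\<Sum>b\<in>Basis. H b v *\<^sub>R b))
        \<le> (\<Sum>b\<in>(Basis::'v set). \<bar>H b u - H b v\<bar>)"
      unfolding sum_subtractf[symmetric] scaleR_diff_left[symmetric]
      by (rule sum_norm_le) simp
    also have "\<dots> \<le> DIM('v) * D u v"
      using H(2) uv by (intro sum_bounded_above) auto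
    finally show "norm ((\<Sum>b\<in>Basis. H b u *\<^sub>R b) - (\<Sum>b\<in>Basis. H b v *\<^sub>R b)) \<le> DIM('v) * D u v" .
  qed
qed

text \<open>Chords are shorter than arcs: the chord over an angle \<open>a\<close> has length \<open>2 R sin (a / 2)\<close>.\<close>

lemma norm_diff_le_sphere_dist:
  fixes x y :: "'v::real_inner"
  assumes "R > 0" "x \<in> sphere 0 R" "y \<in> sphere 0 R"
  shows "norm (x - y) \<le> sphere_dist R x y"
proof -
  have n: "norm x = R" "norm y = R"
    using assms by auto
  define a where "a = arccos ((x \<bullet> y) / R\<^sup>2)"
  have "\<bar>x \<bullet> y\<bar> \<le> R\<^sup>2"
    using Cauchy_Schwarz_ineq2[of x y] n by (simp add: power2_eq_square)
  then have "- 1 \<le> (x \<bullet> y) / R\<^sup>2" "(x \<bullet> y) / R\<^sup>2 \<le> 1"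
    using assms(1) by (auto simp: field_simps)
  then have a: "cos a = (x \<bullet> y) / R\<^sup>2" "0 \<le> a"
    unfolding a_def by (auto intro: cos_arccos arccos_lbound)
  have "(norm (x - y))\<^sup>2 = (norm x)\<^sup>2 + (norm y)\<^sup>2 - 2 * (x \<bullet> y)"
    by (simp add: power2_norm_eq_inner inner_diff_left inner_diff_right inner_commute)
  also have "\<dots> = 2 * R\<^sup>2 * (1 - cos a)"
    using assms(1) by (simp add: n a(1) field_simps)
  also have "1 - cos a = 2 * (sin (a / 2))\<^sup>2"
    using cos_double_sin[of "a / 2"] by simp
  also have "2 * R\<^sup>2 * (2 * (sin (a / 2))\<^sup>2) = (2 * R * \<bar>sin (a / 2)\<bar>)\<^sup>2"
    by (simp add: power_mult_distrib)
  also have "\<dots> \<le> (R * a)\<^sup>2"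
    using abs_sin_x_le_abs_x[of "a / 2"] a(2) assms(1) by (intro power_mono) auto
  finally have "norm (x - y) \<le> R * a"
    using a(2) assms(1) by (simp add: power2_le_iff_abs_le)
  then show ?thesis
    by (simp add: sphere_dist_def a_def)
qed

lemma (in Metric_space) continuous_map_Lipschitz:
  fixes F :: "'a \<Rightarrow> 'v::real_normed_vector"
  assumes "\<And>u v. \<lbrakk>u \<in> M; v \<in> M\<rbrakk> \<Longrightarrow> norm (F u - F v) \<le> L * d u v"
  shows "continuous_map mtopology euclidean F"
proof -
  have "\<exists>\<delta>>0. \<forall>v. v \<in> M \<and> d u v < \<delta> \<longrightarrow> dist (F v) (F u) < e" if "u \<in> M" "e > 0" for u e
  proof (intro exI conjI allI impI)
    show "e / (\<bar>L\<bar> + 1) > 0"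
      using \<open>e > 0\<close> by simp
    fix v assume v: "v \<in> M \<and> d u v < e / (\<bar>L\<bar> + 1)"
    have "norm (F v - F u) \<le> L * d u v"
      using assms[of v u] v \<open>u \<in> M\<close> by (simp add: commute)
    also have "\<dots> \<le> (\<bar>L\<bar> + 1) * d u v"
      by (intro mult_right_mono) auto
    also have "\<dots> < e"
      using v by (simp add: field_simps)
    finally show "dist (F v) (F u) < e"
      by (simp add: dist_norm)
  qed
  then show ?thesis
    using metric_continuous_map[OF Met_TC.Metric_space_axioms, of F]
    by (simp add: dist_commute)
qed

text \<open>The McShane extension \<open>G\<close> moves by less than \<open>DIM('v) * \<rho> \<le> R\<close> over a distance less than \<open>\<rho>\<close>. So if \<open>u\<close>
  is that close to the image of \<open>x\<close>, then \<open>G u\<close> lies in the open ball of radius \<open>R\<close> around \<open>f x\<close>, which is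
  contained in the open half space \<open>v \<bullet> f x > 0\<close>. Radial projection preserves this half space, which
  excludes the antipode of \<open>f x\<close>.\<close>

lemma sphere_valued_extension:
  fixes f :: "'x \<Rightarrow> 'v::euclidean_space" and R \<rho> :: real
  assumes d: "pseudometric_on (topspace X) d" and ne: "topspace X \<noteq> {}"
    and R: "DIM('v) * \<rho> \<le> R" "\<rho> > 0"
    and f: "\<And>x. x \<in> topspace X \<Longrightarrow> f x \<in> sphere 0 R"
    and lip: "\<And>x y. \<lbrakk>x \<in> topspace X; y \<in> topspace X\<rbrakk> \<Longrightarrow> sphere_dist R (f x) (f y) \<le> d x y"
  obtains F where "continuous_map (kuratowski_nbhd X d \<rho>) (top_of_set (sphere 0 R)) F"
    and "\<And>x. x \<in> topspace X \<Longrightarrow> F (kuratowski X d x) = f x"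
    and "\<And>u x. \<lbrakk>u \<in> linf_b X d; x \<in> topspace X; linf_dist X d u (kuratowski X d x) < \<rho>\<rbrakk> \<Longrightarrow> F u \<noteq> - f x"
proof -
  let ?M = "linf_b X d" and ?D = "linf_dist X d" and ?j = "kuratowski X d"
  interpret d: pseudometric_on "topspace X" d by fact
  interpret L: Metric_space ?M ?D by (rule Metric_space_linf_pseudometric[OF d])
  note j = d.kuratowski_in_linf_b[OF HOL.refl]
  have "0 < DIM('v) * \<rho>"
    using R(2) by simp
  then have "R > 0"
    using R(1) by linarith
  have "norm (f x - f y) \<le> ?D (?j x) (?j y)" if "x \<in> topspace X" "y \<in> topspace X" for x y
    using norm_diff_le_sphere_dist[OF \<open>R > 0\<close> f[OF that(1)] f[OF that(2)]] lip[OF that]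
      d.linf_dist_kuratowski[OF HOL.refl that] by simp
  then obtain G where Gf: "\<And>x. x \<in> topspace X \<Longrightarrow> G (?j x) = f x"
    and G: "\<And>u v. \<lbrakk>u \<in> ?M; v \<in> ?M\<rbrakk> \<Longrightarrow> norm (G u - G v) \<le> DIM('v) * ?D u v"
    using McShane_extension_euclidean[OF L.Metric_space_axioms ne, of ?j f] j by metis
  have pos: "G u \<bullet> f x > 0" if u: "u \<in> ?M" and x: "x \<in> topspace X" and near: "?D u (?j x) < \<rho>" for u x
  proof -
    have "norm (G u - f x) \<le> DIM('v) * ?D u (?j x)"
      using G[OF u j[OF x x]] Gf[OF x] by simp
    also have "\<dots> < DIM('v) * \<rho>"
      using near by simp
    also have "\<dots> \<le> R"
      by (rule R(1))
    finally have "norm (G u - f x) * R < R * R"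
      using \<open>R > 0\<close> by simp
    moreover have "\<bar>(G u - f x) \<bullet> f x\<bar> \<le> norm (G u - f x) * R"
      using Cauchy_Schwarz_ineq2[of "G u - f x" "f x"] f[OF x] by simp
    moreover have "f x \<bullet> f x = R * R"
      using f[OF x] by (simp add: dot_square_norm power2_eq_square)
    ultimately show ?thesis
      by (simp add: inner_diff_left)
  qed
  define F where "F u = (R / norm (G u)) *\<^sub>R G u" for u
  show ?thesis
  proof
    show "F (?j x) = f x" if "x \<in> topspace X" for x
      using f[OF that] \<open>R > 0\<close> by (simp add: F_def Gf[OF that])
    show "F u \<noteq> - f x" if "u \<in> ?M" "x \<in> topspace X" "?D u (?j x) < \<rho>" for u x
    proof
      assume "F u = - f x"
      have "G u \<noteq> 0"
        using pos[OF that] by auto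
      then have "F u \<bullet> f x > 0"
        using pos[OF that] \<open>R > 0\<close> by (simp add: F_def)
      moreover have "f x \<bullet> f x \<ge> 0"
        by simp
      ultimately show False
        using \<open>F u = - f x\<close> by simp
    qed
    have "continuous_map (kuratowski_nbhd X d \<rho>) euclidean G"
      unfolding kuratowski_nbhd_def
      by (rule continuous_map_from_subtopology[OF L.continuous_map_Lipschitz[OF G]])
    moreover have "G u \<noteq> 0" if "u \<in> topspace (kuratowski_nbhd X d \<rho>)" for u
      using that pos[of u] by (auto simp: kuratowski_nbhd_def)
    ultimately have "continuous_map (kuratowski_nbhd X d \<rho>) (top_of_set (- {0})) G"
      by (auto simp: continuous_map_in_subtopology)
    moreover have "continuous_map (top_of_set (- {0})) (top_of_set (sphere 0 R)) (\<lambda>v::'v. (R / norm v) *\<^sub>R v)"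
      using \<open>R > 0\<close> by (auto intro!: continuous_intros)
    ultimately have "continuous_map (kuratowski_nbhd X d \<rho>) (top_of_set (sphere 0 R))
        ((\<lambda>v. (R / norm v) *\<^sub>R v) \<circ> G)"
      by (rule continuous_map_compose)
    then show "continuous_map (kuratowski_nbhd X d \<rho>) (top_of_set (sphere 0 R)) F"
      by (simp add: F_def[abs_def] o_def)
  qed
qed

section \<open>Cutting off locally finite chains\<close>

lemma singular_simplex_in_topspace:
  "\<lbrakk>singular_simplex q X \<sigma>; t \<in> standard_simplex q\<rbrakk> \<Longrightarrow> \<sigma> t \<in> topspace X"
  by (auto simp: singular_simplex_def continuous_map_def)

lemma lookup_chain_boundary_sum:
  assumes "finite T"
  shows "Poly_Mapping.lookup (chain_boundary (Suc q) (\<Sum>\<sigma>\<in>T. frag_cmul (c \<sigma>) (frag_of \<sigma>))) \<tau>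
    = (\<Sum>(\<sigma>, k) \<in> Sigma T (\<lambda>\<sigma>. {k. k \<le> Suc q \<and> singular_face (Suc q) k \<sigma> = \<tau>}). (-1) ^ k * c \<sigma>)"
proof -
  have "Poly_Mapping.lookup (chain_boundary (Suc q) (\<Sum>\<sigma>\<in>T. frag_cmul (c \<sigma>) (frag_of \<sigma>))) \<tau>
    = (\<Sum>\<sigma>\<in>T. \<Sum>k\<le>Suc q. if singular_face (Suc q) k \<sigma> = \<tau> then (-1) ^ k * c \<sigma> else 0)"
    by (auto simp: chain_boundary_sum chain_boundary_cmul chain_boundary_of lookup_sum sum_distrib_left
        simp del: sum.atMost_Suc intro!: sum.cong)
  also have "\<dots> = (\<Sum>\<sigma>\<in>T. \<Sum>k | k \<le> Suc q \<and> singular_face (Suc q) k \<sigma> = \<tau>. (-1) ^ k * c \<sigma>)"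
    by (intro sum.cong HOL.refl sum.mono_neutral_cong_right) auto
  finally show ?thesis
    using assms by (simp add: sum.Sigma)
qed

lemma lookup_chain_map_sum:
  assumes "finite T"
  shows "Poly_Mapping.lookup (chain_map q f (\<Sum>\<sigma>\<in>T. frag_cmul (c \<sigma>) (frag_of \<sigma>))) \<tau>
    = (\<Sum>\<sigma> | \<sigma> \<in> T \<and> simplex_map q f \<sigma> = \<tau>. c \<sigma>)"
proof -
  have "Poly_Mapping.lookup (chain_map q f (\<Sum>\<sigma>\<in>T. frag_cmul (c \<sigma>) (frag_of \<sigma>))) \<tau>
    = (\<Sum>\<sigma>\<in>T. if simplex_map q f \<sigma> = \<tau> then c \<sigma> else 0)"
    using assms by (auto simp: chain_map_sum lookup_sum intro!: sum.cong)
  then show ?thesis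
    using assms by (simp add: sum.inter_filter)
qed

text \<open>The filling radius is defined with rational coefficients, but the degree is integral.\<close>

lemma clear_denominators:
  fixes b :: "'s \<Rightarrow> rat"
  assumes "finite T"
  obtains N :: nat and c :: "'s \<Rightarrow> int" where "N > 0" and "\<And>\<sigma>. \<sigma> \<in> T \<Longrightarrow> of_int (c \<sigma>) = of_nat N * b \<sigma>"
proof -
  have "\<exists>N>0. \<exists>c. \<forall>\<sigma>\<in>T. of_int (c \<sigma>) = of_nat N * b \<sigma>"
    using assms
  proof (induction T)
    case empty
    then show ?case by auto
  next
    case (insert s T)
    then obtain N c where N: "N > 0" "\<And>\<sigma>. \<sigma> \<in> T \<Longrightarrow> of_int (c \<sigma>) = of_nat N * b \<sigma>"
      by blast
    obtain p q where q: "b s = Fract p q" "q > 0"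
      by (cases "b s") auto
    let ?N = "N * nat q" and ?c = "\<lambda>\<sigma>. if \<sigma> = s then int N * p else q * c \<sigma>"
    have "of_int (?c \<sigma>) = of_nat ?N * b \<sigma>" if "\<sigma> \<in> insert s T" for \<sigma>
      using that N(2) q by (auto simp: Fract_of_int_quotient field_simps)
    moreover have "?N > 0"
      using N(1) q(2) by simp
    ultimately show ?case
      by (intro exI[of _ ?N] conjI exI[of _ ?c]) auto
  qed
  then show ?thesis
    using that by blast
qed

text \<open>Let \<open>b\<close> be a rational filling of the image of \<open>z\<close> under \<open>j\<close>, and let \<open>\<beta>\<close> consist of the simplices of \<open>b\<close> that
  meet the bounded set \<open>B\<close>, with coefficients multiplied by \<open>N\<close>. A simplex \<open>\<tau>\<close> that meets \<open>B\<close> is a face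
  only of simplices that meet \<open>B\<close>, so \<open>\<tau>\<close> has the same coefficient in the boundary of \<open>\<beta>\<close> as in \<open>N\<close>
  times the image of \<open>z\<close>. The part of \<open>z\<close> that does not meet \<open>K\<close> is the only other source of a difference.\<close>

lemma truncated_filling:
  fixes b :: "('y, rat) lfchain" and z :: "('x, int) lfchain"
  assumes b: "lf_chain (Suc n) U D b"
    and bz: "lf_boundary (Suc n) b = lf_push n j (\<lambda>\<sigma>. of_int (z \<sigma>))"
    and B: "B \<subseteq> topspace U" "u0 \<in> topspace U" "\<forall>u\<in>B. D u0 u \<le> C"
    and fin: "finite {\<sigma>. z \<sigma> \<noteq> 0 \<and> \<sigma> ` standard_simplex n \<inter> K \<noteq> {}}"
  shows "\<exists>N>0. \<exists>\<beta>. singular_chain (Suc n) U \<beta> \<and>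
    (\<forall>\<tau>\<in>Poly_Mapping.keys (frag_cmul (int N) (chain_map n j (part_meeting n K z)) - chain_boundary (Suc n) \<beta>).
      \<tau> ` standard_simplex n \<inter> B = {} \<or>
      (\<exists>\<sigma>. z \<sigma> \<noteq> 0 \<and> \<sigma> ` standard_simplex n \<inter> K = {} \<and> simplex_map n j \<sigma> = \<tau>))"
proof -
  define T where "T = {\<sigma>. b \<sigma> \<noteq> 0 \<and> \<sigma> ` standard_simplex (Suc n) \<inter> B \<noteq> {}}"
  have "finite T"
    using b B unfolding lf_chain_def T_def by blast
  then obtain N c where "N > 0" and c: "\<And>\<sigma>. \<sigma> \<in> T \<Longrightarrow> of_int (c \<sigma>) = of_nat N * b \<sigma>"
    using clear_denominators by blast
  define \<beta> where "\<beta> = (\<Sum>\<sigma>\<in>T. frag_cmul (c \<sigma>) (frag_of \<sigma>))"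
  have "singular_chain (Suc n) U \<beta>"
    using b unfolding \<beta>_def lf_chain_def T_def
    by (intro singular_chain_sum singular_chain_cmul) (simp add: singular_chain_of)
  moreover have "\<exists>\<sigma>. z \<sigma> \<noteq> 0 \<and> \<sigma> ` standard_simplex n \<inter> K = {} \<and> simplex_map n j \<sigma> = \<tau>"
    if \<tau>: "\<tau> \<in> Poly_Mapping.keys (frag_cmul (int N) (chain_map n j (part_meeting n K z))
        - chain_boundary (Suc n) \<beta>)" and meets: "\<tau> ` standard_simplex n \<inter> B \<noteq> {}" for \<tau>
  proof (rule ccontr)
    assume none: "\<not> ?thesis"
    have T: "\<sigma> \<in> T" if "b \<sigma> \<noteq> 0" "k \<le> Suc n" "singular_face (Suc n) k \<sigma> = \<tau>" for \<sigma> k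
    proof -
      obtain x where x: "x \<in> standard_simplex n" "\<tau> x \<in> B"
        using meets by blast
      then have "\<sigma> (simplical_face k x) \<in> B"
        using that(3) by (auto simp: singular_face_def)
      moreover have "simplical_face k x \<in> standard_simplex (Suc n)"
        using simplical_face_in_standard_simplex[of "Suc n" k x] x(1) that(2) by simp
      ultimately show ?thesis
        using that(1) by (auto simp: T_def)
    qed
    have faces: "{(\<sigma>, k). b \<sigma> \<noteq> 0 \<and> k \<le> Suc n \<and> singular_face (Suc n) k \<sigma> = \<tau>}
        = Sigma T (\<lambda>\<sigma>. {k. k \<le> Suc n \<and> singular_face (Suc n) k \<sigma> = \<tau>})"
      using T by (auto simp: T_def)
    have "rat_of_int (Poly_Mapping.lookup (chain_boundary (Suc n) \<beta>) \<tau>) = of_nat N * lf_boundary (Suc n) b \<tau>"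
      unfolding \<beta>_def lookup_chain_boundary_sum[OF \<open>finite T\<close>] lf_boundary_def faces
      by (auto simp: of_int_sum sum_distrib_left c intro!: sum.cong)
    also have "lf_boundary (Suc n) b \<tau> = (\<Sum>\<sigma> | z \<sigma> \<noteq> 0 \<and> simplex_map n j \<sigma> = \<tau>. of_int (z \<sigma>))"
      by (simp add: bz lf_push_def)
    also have "{\<sigma>. z \<sigma> \<noteq> 0 \<and> simplex_map n j \<sigma> = \<tau>}
        = {\<sigma> \<in> {\<sigma>. z \<sigma> \<noteq> 0 \<and> \<sigma> ` standard_simplex n \<inter> K \<noteq> {}}. simplex_map n j \<sigma> = \<tau>}"
      using none by blast
    also have "(\<Sum>\<sigma>\<in>\<dots>. rat_of_int (z \<sigma>))
        = of_int (Poly_Mapping.lookup (chain_map n j (part_meeting n K z)) \<tau>)"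
      unfolding part_meeting_def lookup_chain_map_sum[OF fin] by simp
    finally have "rat_of_int (Poly_Mapping.lookup (chain_boundary (Suc n) \<beta>) \<tau>)
        = of_int (int N * Poly_Mapping.lookup (chain_map n j (part_meeting n K z)) \<tau>)"
      by simp
    then have "Poly_Mapping.lookup (chain_boundary (Suc n) \<beta>) \<tau>
        = int N * Poly_Mapping.lookup (chain_map n j (part_meeting n K z)) \<tau>"
      using of_int_eq_iff by blast
    then show False
      using \<tau> by (simp add: in_keys_iff lookup_minus)
  qed
  ultimately show ?thesis
    using \<open>N > 0\<close> by blast
qed

section \<open>Homology of a sphere relative to a punctured sphere\<close>

lemma sphere_point_neq_antipode:
  fixes y :: "'v::real_normed_vector"
  assumes "R > 0" and "y \<in> sphere 0 R"
  shows "y \<noteq> - y"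
proof
  assume "y = - y"
  then have "2 *\<^sub>R y = 0"
    by (metis add.right_inverse scaleR_2)
  then show False
    using assms by simp
qed

text \<open>The homology of the combinatorial spheres \<open>nsphere\<close> is transported along a homeomorphism with
  the Euclidean sphere, and the reduced homology of a space is its homology relative to a point.\<close>

lemma relative_homology_group_sphere_point:
  fixes y0 :: "'v::euclidean_space"
  assumes "R > 0" and "y0 \<in> sphere 0 R"
  shows "relative_homology_group (int (DIM('v) - 1)) (top_of_set (sphere 0 R)) {y0} \<cong> integer_group"
proof -
  let ?p = "int (DIM('v) - 1)" and ?S = "top_of_set (sphere (0::'v) R)"
  have "nsphere (DIM('v) - 1) homeomorphic_space top_of_set (sphere (0::'v) 1)"
    by (rule homeomorphic_maps_nsphere_euclidean_sphere[of "Basis :: 'v set" "DIM('v)"])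
      (auto simp: independent_Basis orthogonal_Basis homeomorphic_space_def)
  also have "top_of_set (sphere (0::'v) 1) homeomorphic_space ?S"
    using homeomorphic_spheres[of 1 R "0::'v" 0] \<open>R > 0\<close>
    by (auto simp: homeomorphic_def homeomorphic_space_def
        intro: homeomorphic_maps_iff_homeomorphism[THEN iffD2])
  finally have sph: "reduced_homology_group ?p (nsphere (DIM('v) - 1)) \<cong> reduced_homology_group ?p ?S"
    by (rule homeomorphic_space_imp_isomorphic_reduced_homology_groups)
  have "relative_homology_group ?p ?S {y0} \<cong> reduced_homology_group ?p ?S"
    using assms by (intro isomorphic_relative_homology_by_singleton) auto
  also have "\<dots> \<cong> reduced_homology_group ?p (nsphere (DIM('v) - 1))"
    by (rule group.iso_sym[OF group_reduced_homology_group sph])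
  also have "\<dots> \<cong> integer_group"
    by (rule reduced_homology_group_nsphere(1))
  finally show ?thesis .
qed

text \<open>An element of finite order generates a finite group.\<close>

lemma is_generator_int_pow_eq_one:
  assumes "group G" and iso: "G \<cong> integer_group" and gen: "is_generator G e"
    and one: "e [^]\<^bsub>G\<^esub> (m::int) = \<one>\<^bsub>G\<^esub>"
  shows "m = 0"
proof (rule ccontr)
  assume "m \<noteq> 0"
  interpret group G by fact
  have e: "e \<in> carrier G" "subgroup_generated G {e} = G"
    using gen by (auto simp: is_generator_def)
  have "finite (carrier G)"
    using finite_cyclic_subgroup_int[OF e(1)] e(2) one \<open>m \<noteq> 0\<close> by auto
  moreover obtain h where "bij_betw h (carrier G) (UNIV :: int set)"
    using iso by (auto simp: is_iso_def iso_def)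
  ultimately show False
    using bij_betw_finite infinite_UNIV_int by blast
qed

text \<open>Taking relative homology classes is a group homomorphism.\<close>

lemma homologous_rel_set_frag_cmul:
  assumes "singular_relcycle p X S w"
  shows "homologous_rel_set p X S (frag_cmul (int N) w)
    = homologous_rel_set p X S w [^]\<^bsub>relative_homology_group (int p) X S\<^esub> N"
proof (induction N)
  case 0
  show ?case
    by (simp add: homologous_rel_set_eq_relboundary)
next
  case (Suc N)
  let ?G = "relative_homology_group (int p) X S"
  have "homologous_rel_set p X S (u + v) = homologous_rel_set p X S u \<otimes>\<^bsub>?G\<^esub> homologous_rel_set p X S v"
    if "singular_relcycle p X S u" "singular_relcycle p X S v" for u v
  proof -
    have "r_coset (relcycle_group p X S) (singular_relboundary_set p X S) \<in> hom (relcycle_group p X S) ?G"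
      unfolding nontrivial_relative_homology_group
      by (rule normal.r_coset_hom_Mod[OF normal_subgroup_singular_relboundary_relcycle])
    then show ?thesis
      using that by (simp add: right_coset_singular_relboundary hom_def)
  qed
  from this[OF singular_relcycle_cmul[OF assms] assms, of "int N"] show ?case
    using Suc.IH by (simp add: frag_cmul_distrib add.commute)
qed

text \<open>The punctured sphere \<open>sphere 0 R - {- y0}\<close> is homeomorphic to a hyperplane, hence contractible like
  its subset \<open>{y0}\<close>, so that the homology groups relative to these two sets agree. A cycle relative to
  \<open>y0\<close> therefore represents a torsion class as soon as a multiple of it bounds relative to the
  punctured sphere; but the group is infinite cyclic.\<close>

lemma degree_eq_0_if_multiple_bounds_rel_punctured_sphere:
  fixes y0 :: "'v::euclidean_space"
  defines "n \<equiv> DIM('v) - 1"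
  assumes "R > 0" and y0: "y0 \<in> sphere 0 R"
    and w: "singular_relcycle n (top_of_set (sphere 0 R)) {y0} w"
    and "N > 0"
    and bd: "singular_relboundary n (top_of_set (sphere 0 R)) (sphere 0 R - {- y0}) (frag_cmul (int N) w)"
    and gen: "is_generator (relative_homology_group (int n) (top_of_set (sphere 0 R)) {y0}) e"
    and k: "homologous_rel_set n (top_of_set (sphere 0 R)) {y0} w
      = e [^]\<^bsub>relative_homology_group (int n) (top_of_set (sphere 0 R)) {y0}\<^esub> (k::int)"
  shows "k = 0"
proof -
  let ?S = "top_of_set (sphere (0::'v) R)" and ?A = "sphere 0 R - {- y0}"
  let ?G = "relative_homology_group (int n) ?S {y0}"
  let ?H = "relative_homology_group (int n) ?S ?A"
  let ?j = "hom_induced (int n) ?S {y0} ?S ?A id"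
  interpret G: group ?G by simp
  have ne: "y0 \<noteq> - y0"
    by (rule sphere_point_neq_antipode[OF \<open>R > 0\<close> y0])
  have "contractible ?A"
  proof -
    obtain c :: 'v where "c \<in> Basis"
      by (rule SOME_Basis[THEN that])
    then have "?A homeomorphic {x. c \<bullet> x = 0}"
      using homeomorphic_punctured_sphere_hyperplane[of R "- y0" 0 c 0] assms by force
    then show ?thesis
      by (simp add: homeomorphic_contractible_eq convex_hyperplane convex_imp_contractible)
  qed
  moreover have "sphere 0 R \<inter> ?A = ?A"
    by auto
  ultimately have "?j \<in> iso ?G ?H"
    using y0 ne
    by (intro iso_hom_induced_relativization_contractible) (auto simp: subtopology_subtopology)
  then have inj: "inj_on ?j (carrier ?G)" and hom: "?j \<in> hom ?G ?H"
    by (auto simp: iso_def bij_betw_def)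
  let ?c = "homologous_rel_set n ?S {y0} (frag_cmul (int N) w)"
  have c: "?c \<in> carrier ?G"
    using singular_relcycle_cmul[OF w] by (auto simp: carrier_relative_homology_group)
  have "?j ?c = homologous_rel_set n ?S ?A (chain_map n id (frag_cmul (int N) w))"
    using y0 ne by (intro hom_induced_chain_map singular_relcycle_cmul w) auto
  also have "chain_map n id (frag_cmul (int N) w) = frag_cmul (int N) w"
    using singular_relcycle_cmul[OF w, of "int N"]
    by (intro chain_map_ident) (auto simp: singular_relcycle)
  also have "homologous_rel_set n ?S ?A (frag_cmul (int N) w) = \<one>\<^bsub>?H\<^esub>"
    using bd by (simp only: homologous_rel_set_eq_relboundary one_relative_homology_group)
  also have "\<dots> = ?j \<one>\<^bsub>?G\<^esub>"
    using hom_one[OF hom] by simp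
  finally have "?j ?c = ?j \<one>\<^bsub>?G\<^esub>" .
  then have "?c = \<one>\<^bsub>?G\<^esub>"
    by (rule inj_onD[OF inj _ c G.one_closed])
  then have "(e [^]\<^bsub>?G\<^esub> k) [^]\<^bsub>?G\<^esub> int N = \<one>\<^bsub>?G\<^esub>"
    using homologous_rel_set_frag_cmul[OF w, of N] k by (simp only: int_pow_int)
  then have "e [^]\<^bsub>?G\<^esub> (k * int N) = \<one>\<^bsub>?G\<^esub>"
    using gen by (simp add: is_generator_def G.int_pow_pow)
  moreover have "?G \<cong> integer_group"
    unfolding n_def by (rule relative_homology_group_sphere_point[OF \<open>R > 0\<close> y0])
  ultimately have "k * int N = 0"
    by (intro is_generator_int_pow_eq_one[OF _ _ gen]) auto
  then show ?thesis
    using \<open>N > 0\<close> by simp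
qed

section \<open>Filling radius and degree\<close>

text \<open>A filling close to the Kuratowski image would be carried by the sphere-valued extension of \<open>f\<close> to a
  chain that bounds a multiple of the image of the fundamental cycle relative to a punctured
  sphere.\<close>

lemma le_FillRad_if_nonzero_degree:
  fixes f :: "'x \<Rightarrow> (real^'n::finite) \<times> real" and r R :: real
  assumes d: "pseudometric_on (topspace X) d"
    and bdd: "\<And>K x. \<lbrakk>compactin X K; x \<in> topspace X\<rbrakk> \<Longrightarrow> \<exists>C. \<forall>y\<in>K. d x y \<le> C"
    and x0: "x0 \<in> topspace X"
    and z: "lf_chain CARD('n) X d z"
    and f: "continuous_map X (top_of_set (sphere 0 R)) f"
    and lip: "\<And>x y. \<lbrakk>x \<in> topspace X; y \<in> topspace X\<rbrakk> \<Longrightarrow> sphere_dist R (f x) (f y) \<le> d x y"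
    and deg: "has_degree X z R f k" "k \<noteq> 0"
    and R: "R > 0" "DIM((real^'n) \<times> real) * r \<le> R"
  shows "ereal r \<le> FillRad CARD('n) X d z"
proof (rule ccontr)
  let ?n = "CARD('n)" and ?S = "top_of_set (sphere (0 :: (real^'n) \<times> real) R)"
  let ?D = "linf_dist X d" and ?j = "kuratowski X d"
  assume "\<not> ?thesis"
  then obtain \<rho> and b :: "('x \<Rightarrow> real, rat) lfchain" where \<rho>: "0 < \<rho>" "\<rho> < r"
    and b: "lf_chain (Suc ?n) (kuratowski_nbhd X d \<rho>) ?D b"
    and bz: "lf_boundary (Suc ?n) b = lf_push ?n ?j (\<lambda>\<sigma>. of_int (z \<sigma>))"
    unfolding FillRad_def by (auto simp: not_le Inf_less_iff)
  define U where "U = kuratowski_nbhd X d \<rho>"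
  interpret d: pseudometric_on "topspace X" d by fact
  interpret L: Metric_space "linf_b X d" ?D by (rule Metric_space_linf_pseudometric[OF d])
  note j = d.kuratowski_in_linf_b[OF HOL.refl]
  have topU: "topspace U = {u \<in> linf_b X d. \<exists>x\<in>topspace X. ?D u (?j x) < \<rho>}"
    by (auto simp: U_def kuratowski_nbhd_def)
  have jU: "?j x \<in> topspace U" if "x \<in> topspace X" for x
    using that j[OF that that] \<rho>(1) by (force simp: topU)

  obtain K y0 e where K: "compactin X K" and y0: "y0 \<in> sphere 0 R"
    and outside: "\<And>x. x \<in> topspace X - K \<Longrightarrow> f x = y0"
    and e: "is_generator (relative_homology_group (int ?n) ?S {y0}) e"
    and fk: "hom_induced (int ?n) X (topspace X - K) ?S {y0} f (class_rel_compl ?n X K z)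
        = e [^]\<^bsub>relative_homology_group (int ?n) ?S {y0}\<^esub> k"
    using deg(1) by (auto simp: has_degree_def Let_def)
  let ?G = "relative_homology_group (int ?n) ?S {y0}"
  have dim: "DIM((real^'n) \<times> real) - 1 = ?n"
    by simp
  define a where "a = part_meeting ?n K z"
  define w where "w = chain_map ?n f a"

  \<comment> \<open>Induced maps send everything that is not a homology class to the neutral element. As the degree is
    nonzero, the part of the cycle that meets \<open>K\<close> must be a relative cycle.\<close>
  have "e [^]\<^bsub>?G\<^esub> k \<noteq> \<one>\<^bsub>?G\<^esub>"
    using is_generator_int_pow_eq_one[OF _ _ e] relative_homology_group_sphere_point[OF R(1) y0] deg(2)
    by (auto simp: dim)
  then have "class_rel_compl ?n X K z \<in> carrier (relative_homology_group (int ?n) X (topspace X - K))"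
    using fk hom_induced_default by metis
  then have a: "singular_relcycle ?n X (topspace X - K) a"
    using homologous_rel_singular_relcycle
    by (fastforce simp: class_rel_compl_def a_def carrier_relative_homology_group homologous_rel_set_eq)
  then have a_chain: "singular_chain ?n X a"
    by (simp add: singular_relcycle)
  have w: "singular_relcycle ?n ?S {y0} w"
    unfolding w_def using outside by (intro singular_relcycle_chain_map[OF a f]) auto
  have wk: "homologous_rel_set ?n ?S {y0} w = e [^]\<^bsub>?G\<^esub> k"
    using fk hom_induced_chain_map[OF f _ a, of "{y0}"] outside
    by (simp add: class_rel_compl_def a_def w_def Pi_iff)

  have "DIM((real^'n) \<times> real) * \<rho> \<le> DIM((real^'n) \<times> real) * r"
    using \<rho>(2) by (intro mult_left_mono) auto
  then have "real DIM((real^'n) \<times> real) * \<rho> \<le> R"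
    using R(2) by linarith
  have sph: "f x \<in> sphere 0 R" if "x \<in> topspace X" for x
    using f that by (auto simp: continuous_map_in_subtopology Pi_iff)
  obtain F where F: "continuous_map U ?S F"
    and Fj: "\<And>x. x \<in> topspace X \<Longrightarrow> F (?j x) = f x"
    and antipode: "\<And>u x. \<lbrakk>u \<in> linf_b X d; x \<in> topspace X; ?D u (?j x) < \<rho>\<rbrakk> \<Longrightarrow> F u \<noteq> - f x"
  proof (rule sphere_valued_extension[OF d _ \<open>real DIM((real^'n) \<times> real) * \<rho> \<le> R\<close> \<rho>(1), where f = f, folded U_def])
    fix F assume "continuous_map U ?S F" "\<And>x. x \<in> topspace X \<Longrightarrow> F (?j x) = f x"
      "\<And>u x. \<lbrakk>u \<in> linf_b X d; x \<in> topspace X; ?D u (?j x) < \<rho>\<rbrakk> \<Longrightarrow> F u \<noteq> - f x"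
    then show thesis
      by (rule that)
  qed (use x0 sph lip in auto)

  \<comment> \<open>Outside \<open>B\<close> the nearby points of \<open>X\<close> lie outside \<open>K\<close>, so \<open>F\<close> misses \<open>- y0\<close> there.\<close>
  define B where "B = {u \<in> topspace U. \<exists>x\<in>K. ?D u (?j x) < \<rho>}"
  have KX: "K \<subseteq> topspace X"
    using K by (rule compactin_subset_topspace)
  obtain C where C: "\<And>y. y \<in> K \<Longrightarrow> d x0 y \<le> C"
    using bdd[OF K x0] by blast
  have B_bdd: "\<forall>u\<in>B. ?D (?j x0) u \<le> C + \<rho>"
  proof
    fix u assume "u \<in> B"
    then obtain x where x: "x \<in> K" "?D u (?j x) < \<rho>" and u: "u \<in> linf_b X d"
      by (auto simp: B_def topU)
    then have xX: "x \<in> topspace X"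
      using KX by blast
    have "?D (?j x0) u \<le> ?D (?j x0) (?j x) + ?D (?j x) u"
      using L.triangle[OF j[OF x0 x0] j[OF xX xX] u] .
    then show "?D (?j x0) u \<le> C + \<rho>"
      using C[OF x(1)] x(2) d.linf_dist_kuratowski[OF HOL.refl x0 xX] L.commute[of u] by simp
  qed
  have fin: "finite {\<sigma>. z \<sigma> \<noteq> 0 \<and> \<sigma> ` standard_simplex ?n \<inter> K \<noteq> {}}"
    using z KX x0 C unfolding lf_chain_def by blast
  have BU: "B \<subseteq> topspace U"
    by (auto simp: B_def)
  obtain N \<beta> where "N > 0" and \<beta>: "singular_chain (Suc ?n) U \<beta>"
    and keys: "\<forall>\<tau>\<in>Poly_Mapping.keys (frag_cmul (int N) (chain_map ?n ?j a) - chain_boundary (Suc ?n) \<beta>).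
      \<tau> ` standard_simplex ?n \<inter> B = {} \<or>
      (\<exists>\<sigma>. z \<sigma> \<noteq> 0 \<and> \<sigma> ` standard_simplex ?n \<inter> K = {} \<and> simplex_map ?n ?j \<sigma> = \<tau>)"
    using truncated_filling[OF b[folded U_def] bz BU jU[OF x0] _ fin, OF B_bdd, folded a_def]
    by (elim exE conjE)
  \<comment> \<open>The chain \<open>\<zeta>\<close> has only simplices that miss \<open>B\<close> or that come from simplices of \<open>z\<close> missing \<open>K\<close>. The
    former are sent by \<open>F\<close> away from \<open>- y0\<close>, the latter to the point \<open>y0\<close>.\<close>
  define \<zeta> where "\<zeta> = frag_cmul (int N) (chain_map ?n ?j a) - chain_boundary (Suc ?n) \<beta>"

  have Fj_simplex: "simplex_map ?n F (simplex_map ?n ?j \<sigma>) = simplex_map ?n f \<sigma>"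
    if "singular_simplex ?n X \<sigma>" for \<sigma>
    using simplex_map_eq[OF that, of "F \<circ> ?j" f] Fj by (simp add: simplex_map_compose)
  have "chain_map ?n F (chain_map ?n ?j a) = chain_map ?n (F \<circ> ?j) a"
    by (simp add: chain_map_compose)
  also have "\<dots> = w"
    unfolding w_def using Fj by (intro chain_map_eq[OF a_chain]) simp
  finally have "frag_cmul (int N) w = chain_boundary (Suc ?n) (chain_map (Suc ?n) F \<beta>) + chain_map ?n F \<zeta>"
    using chain_boundary_chain_map[OF \<beta>, of F] by (simp add: \<zeta>_def chain_map_diff)
  moreover have "singular_chain (Suc ?n) ?S (chain_map (Suc ?n) F \<beta>)"
    by (rule singular_chain_chain_map[OF \<beta> F])
  moreover have "singular_chain ?n (subtopology ?S (sphere 0 R - {- y0})) (chain_map ?n F \<zeta>)"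
    unfolding chain_map_def
  proof (rule singular_chain_extend)
    fix \<tau> assume \<tau>: "\<tau> \<in> Poly_Mapping.keys \<zeta>"
    have "\<tau> \<in> Poly_Mapping.keys (frag_cmul (int N) (chain_map ?n ?j a))
        \<union> Poly_Mapping.keys (chain_boundary (Suc ?n) \<beta>)"
      by (rule subsetD[OF keys_diff \<tau>[unfolded \<zeta>_def]])
    then consider "\<tau> \<in> Poly_Mapping.keys (chain_boundary (Suc ?n) \<beta>)"
      | "\<tau> \<in> Poly_Mapping.keys (chain_map ?n ?j a)"
      by auto
    then have F\<tau>: "singular_simplex ?n ?S (simplex_map ?n F \<tau>)"
      and \<tau>U: "\<And>t. t \<in> standard_simplex ?n \<Longrightarrow> \<tau> t \<in> topspace U"
    proof (atomize (full), cases)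
      case 1
      then have \<tau>: "singular_simplex ?n U \<tau>"
        using singular_chain_boundary_alt[OF \<beta>] by (auto simp: singular_chain_def)
      show "singular_simplex ?n ?S (simplex_map ?n F \<tau>) \<and> (\<forall>t. t \<in> standard_simplex ?n \<longrightarrow> \<tau> t \<in> topspace U)"
        using singular_simplex_simplex_map[OF \<tau> F] singular_simplex_in_topspace[OF \<tau>] by simp
    next
      case 2
      then obtain \<sigma> where \<sigma>: "\<sigma> \<in> Poly_Mapping.keys a" "\<tau> = simplex_map ?n ?j \<sigma>"
        using keys_frag_extend[of "frag_of \<circ> simplex_map ?n ?j" a] by (auto simp: chain_map_def keys_frag_of)
      then have \<sigma>X: "singular_simplex ?n X \<sigma>"
        using a_chain by (auto simp: singular_chain_def)
      show "singular_simplex ?n ?S (simplex_map ?n F \<tau>) \<and> (\<forall>t. t \<in> standard_simplex ?n \<longrightarrow> \<tau> t \<in> topspace U)"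
        using singular_simplex_simplex_map[OF \<sigma>X f] Fj_simplex[OF \<sigma>X]
          jU[OF singular_simplex_in_topspace[OF \<sigma>X]] \<sigma>(2) by (simp add: simplex_map_def)
    qed
    have "F (\<tau> t) \<noteq> - y0" if t: "t \<in> standard_simplex ?n" for t
      using bspec[OF keys \<tau>[unfolded \<zeta>_def]]
    proof
      assume "\<tau> ` standard_simplex ?n \<inter> B = {}"
      then have "\<tau> t \<notin> B" and "\<tau> t \<in> topspace U"
        using t \<tau>U by auto
      then obtain x where "\<tau> t \<in> linf_b X d" "x \<in> topspace X - K" "?D (\<tau> t) (?j x) < \<rho>"
        by (auto simp: B_def topU)
      then show ?thesis
        using antipode[of "\<tau> t" x] outside[of x] by auto
    next
      assume "\<exists>\<sigma>. z \<sigma> \<noteq> 0 \<and> \<sigma> ` standard_simplex ?n \<inter> K = {} \<and> simplex_map ?n ?j \<sigma> = \<tau>"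
      then obtain \<sigma> where \<sigma>: "z \<sigma> \<noteq> 0" "\<sigma> t \<notin> K" "simplex_map ?n ?j \<sigma> = \<tau>"
        using t by blast
      then have "singular_simplex ?n X \<sigma>"
        using z by (simp add: lf_chain_def)
      then have "\<sigma> t \<in> topspace X - K"
        using singular_simplex_in_topspace[OF _ t] \<sigma>(2) by blast
      then have "F (\<tau> t) = y0"
        using Fj[of "\<sigma> t"] outside \<sigma>(3) t by (auto simp: simplex_map_def)
      then show ?thesis
        using sphere_point_neq_antipode[OF R(1) y0] by simp
    qed
    moreover have "F (\<tau> t) \<in> sphere 0 R" if "t \<in> standard_simplex ?n" for t
      using singular_simplex_in_topspace[OF F\<tau> that] that by (simp add: simplex_map_def)
    ultimately have "simplex_map ?n F \<tau> ` standard_simplex ?n \<subseteq> sphere 0 R - {- y0}"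
      by (intro image_subsetI) (simp add: simplex_map_def)
    then show "singular_chain ?n (subtopology ?S (sphere 0 R - {- y0})) ((frag_of \<circ> simplex_map ?n F) \<tau>)"
      using F\<tau> by (simp add: singular_chain_of singular_simplex_subtopology)
  qed
  ultimately have "singular_relboundary ?n ?S (sphere 0 R - {- y0}) (frag_cmul (int N) w)"
    unfolding singular_relboundary by metis
  then have "k = 0"
    using degree_eq_0_if_multiple_bounds_rel_punctured_sphere[OF R(1) y0 _ \<open>N > 0\<close>, of w e k] w e wk
    by (simp only: dim)
  then show False
    using deg(2) by simp
qed

theorem proposition2p19:
  fixes M :: "'a topology" and A :: "('a, 'n::finite) chart set"
  assumes "closed_manifold M A" and "enlargeable M A"
  shows "filling_enlargeable M A"
  unfolding filling_enlargeable_def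
proof (intro conjI allI impI)
  show "closed_manifold M A" "orientable M A"
    using assms by (auto simp: enlargeable_def)
  fix g :: "('a, 'n) polyhedral" and r :: real
  assume gr: "polyhedral_metric M A g \<and> r > 0"
  \<comment> \<open>The dimension of the ambient space of the sphere is the Lipschitz constant of the
    coordinatewise extension.\<close>
  let ?R = "real DIM((real^'n) \<times> real) * r"
  have "?R > 0"
    using gr by simp
  then obtain X p z and f :: "'a \<times> nat \<Rightarrow> (real^'n) \<times> real" and k
    where cov: "connected_covering X M p"
      and z: "fundamental_cycle CARD('n) X (lifted_dist X p g) z"
      and f: "continuous_map X (top_of_set (sphere 0 ?R)) f"
        "\<And>x y. \<lbrakk>x \<in> topspace X; y \<in> topspace X\<rbrakk> \<Longrightarrow> sphere_dist ?R (f x) (f y) \<le> lifted_dist X p g x y"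
      and k: "k \<noteq> 0" "has_degree X z ?R f k"
    using assms(2) gr unfolding enlargeable_def by meson
  have g: "polyhedral_metric M A g"
    using gr by simp
  have "p ` topspace X = topspace M" "topspace M \<noteq> {}"
    using cov assms(1) by (auto simp: connected_covering_def covering_map_def closed_manifold_def)
  then obtain x0 where x0: "x0 \<in> topspace X"
    by blast
  have "ereal r \<le> FillRad CARD('n) X (lifted_dist X p g) z"
  proof (rule le_FillRad_if_nonzero_degree[OF pseudometric_lifted_dist[OF g cov] _ x0 _ f k(2,1) \<open>?R > 0\<close> order.refl])
    show "\<exists>C. \<forall>y\<in>K. lifted_dist X p g x y \<le> C" if "compactin X K" "x \<in> topspace X" for K x
      by (rule lifted_dist_bounded_on_compact[OF g cov that])
    show "lf_chain CARD('n) X (lifted_dist X p g) z"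
      using z by (simp add: fundamental_cycle_def)
  qed
  then show "\<exists>X p z. connected_covering X M p \<and>
      fundamental_cycle CARD('n) X (lifted_dist X p g) z \<and>
      FillRad CARD('n) X (lifted_dist X p g) z \<ge> ereal r"
    using cov z by blast
qed

end
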